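(* Let $\lambda=(\lambda_n)$ be a frequency. Then $\mathcal{D}_{\infty,+}(\lambda)$ is a pre-Fréchet Schwartz space which admits the following representations as a projective limit (isomorphisms of pre-Fréchet spaces): \[ \mathcal{D}_{\infty,+}(\lambda)=\mathrm{proj}\,(\mathcal{D}_{\infty,k}(\lambda),i_k)=\mathrm{proj}\,(\mathcal{D}_{\infty}(\lambda),\tau_k), \] the first given by $D\mapsto (D)_{k=1}^\infty$ and the second by $D\mapsto (D_{1/k})_{k=1}^\infty$.
   Context: A frequency is a strictly increasing unbounded sequence $\lambda=(\lambda_n)_{n\ge 1}$ of non-negative real numbers. A $\lambda$-Dirichlet series is a formal series $D=\sum a_n e^{-\lambda_n s}$ with $a_n\in\mathbb{C}$; $\mathfrak{D}(\lambda)$ is the set of all of them. For $\sigma>0$ put $D_\sigma=\sum a_n e^{-\lambda_n\sigma}e^{-\lambda_n s}$. Write $[\mathrm{Re}>\sigma]=\{s\in\mathbb{C}:\mathrm{Re}\,s>\sigma\}$. $\mathcal{D}_\infty(\lambda)$ is the normed space of all $\lambda$-Dirichlet series converging on $[\mathrm{Re}>0]$ to a bounded function, with norm $\|D\|_\infty=\sup_{\mathrm{Re}\,s>0}|D(s)|$. $\mathcal{D}_{\infty,+}(\lambda)$ is the space of all $\lambda$-Dirichlet series converging on $[\mathrm{Re}>0]$ to a function bounded on $[\mathrm{Re}>\sigma]$ for each $\sigma>0$ (equivalently, $D_\sigma\in\mathcal{D}_\infty(\lambda)$ for all $\sigma>0$), with the topology given by the norms $\|D\|_k=\|D_{1/k}\|_\infty$,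 $k\in\mathbb{N}$. For $k\in\mathbb{N}$, $\mathcal{D}_{\infty,k}(\lambda)=\{D\in\mathfrak{D}(\lambda): D_{1/k}\in\mathcal{D}_\infty(\lambda)\}$ with norm $\|D\|_k=\|D_{1/k}\|_\infty$; $i_k:\mathcal{D}_{\infty,k+1}(\lambda)\to\mathcal{D}_{\infty,k}(\lambda)$ is the canonical injection; $\tau_k:\mathcal{D}_\infty(\lambda)\to\mathcal{D}_\infty(\lambda)$ is $D\mapsto D_{\frac1k-\frac1{k+1}}$. For normed spaces $X_k$ and bounded operators $j_k:X_{k+1}\to X_k$, $\mathrm{proj}(X_k,j_k)$ is the topological subspace of $\prod_k X_k$ of all $(x_k)$ with $j_k(x_{k+1})=x_k$ for all $k$. A pre-Fréchet space is a Hausdorff locally convex space whose topology is given by countably many seminorms. A locally convex space $E$ with a directed family $\mathcal{P}$ of seminorms is Schwartz if for every $q\in\mathcal{P}$ there are $p\in\mathcal{P}$, $c>0$ with $q\le cp$ such that the canonical map $E/\ker p\to E/\ker q$ between the associated normed spaces is precompact (maps the unit ball to a precompact set). *)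

theory Defs
  imports "HOL-Analysis.Analysis" "HOL-Library.Function_Algebras"
begin

section \<open>Seminormed spaces on carrier sets\<close>

text \<open>
  All spaces occurring here are linear subspaces \<open>X\<close> of a complex vector space given by an
  abelian group type \<open>'a\<close> and a scalar multiplication \<open>s\<close>. Properties of maps and seminorms
  are only required on the carriers.
\<close>

definition vector_subspace :: "(complex \<Rightarrow> 'a::ab_group_add \<Rightarrow> 'a) \<Rightarrow> 'a set \<Rightarrow> bool" where
  "vector_subspace s X \<longleftrightarrow> vector_space s \<and> module.subspace s X"

definition seminorm_on ::
    "(complex \<Rightarrow> 'a::ab_group_add \<Rightarrow> 'a) \<Rightarrow> 'a set \<Rightarrow> ('a \<Rightarrow> real) \<Rightarrow> bool" where
  "seminorm_on s X p \<longleftrightarrow>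
     vector_subspace s X \<and>
     (\<forall>x\<in>X. 0 \<le> p x) \<and>
     (\<forall>c. \<forall>x\<in>X. p (s c x) = cmod c * p x) \<and>
     (\<forall>x\<in>X. \<forall>y\<in>X. p (x + y) \<le> p x + p y)"

definition norm_on ::
    "(complex \<Rightarrow> 'a::ab_group_add \<Rightarrow> 'a) \<Rightarrow> 'a set \<Rightarrow> ('a \<Rightarrow> real) \<Rightarrow> bool" where
  "norm_on s X p \<longleftrightarrow> seminorm_on s X p \<and> (\<forall>x\<in>X. p x = 0 \<longrightarrow> x = 0)"

definition seminorm_topology :: "'a::ab_group_add set \<Rightarrow> ('a \<Rightarrow> real) set \<Rightarrow> 'a topology" where
  "seminorm_topology X P = topology (\<lambda>U. U \<subseteq> X \<and>
     (\<forall>x\<in>U. \<exists>F e. finite F \<and> F \<subseteq> P \<and> 0 < e \<and> {y\<in>X. \<forall>p\<in>F. p (y - x) < e} \<subseteq> U))"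

lemma openin_seminorm_topology:
  "openin (seminorm_topology X P) U \<longleftrightarrow> U \<subseteq> X \<and>
     (\<forall>x\<in>U. \<exists>F e. finite F \<and> F \<subseteq> P \<and> 0 < e \<and> {y\<in>X. \<forall>p\<in>F. p (y - x) < e} \<subseteq> U)"
proof -
  let ?N = "\<lambda>x F e. {y\<in>X. \<forall>p\<in>F. p (y - x) < (e::real)}"
  have "istopology (\<lambda>U. U \<subseteq> X \<and>
          (\<forall>x\<in>U. \<exists>F e. finite F \<and> F \<subseteq> P \<and> 0 < e \<and> ?N x F e \<subseteq> U))"
    unfolding istopology_def
  proof (intro conjI allI impI ballI)
    fix U V x
    assume U: "U \<subseteq> X \<and> (\<forall>x\<in>U. \<exists>F e. finite F \<and> F \<subseteq> P \<and> 0 < e \<and> ?N x F e \<subseteq> U)"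
      and V: "V \<subseteq> X \<and> (\<forall>x\<in>V. \<exists>F e. finite F \<and> F \<subseteq> P \<and> 0 < e \<and> ?N x F e \<subseteq> V)"
      and x: "x \<in> U \<inter> V"
    from U x have "\<exists>F e. finite F \<and> F \<subseteq> P \<and> 0 < e \<and> ?N x F e \<subseteq> U"
      by simp
    then obtain F e where F: "finite F" "F \<subseteq> P" "0 < e" "?N x F e \<subseteq> U"
      by (elim exE conjE) (rule that)
    from V x have "\<exists>G d. finite G \<and> G \<subseteq> P \<and> 0 < d \<and> ?N x G d \<subseteq> V"
      by simp
    then obtain G d where G: "finite G" "G \<subseteq> P" "0 < d" "?N x G d \<subseteq> V"
      by (elim exE conjE) (rule that)
    have "?N x (F \<union> G) (min e d) \<subseteq> ?N x F e \<inter> ?N x G d"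
      by auto
    then have "?N x (F \<union> G) (min e d) \<subseteq> U \<inter> V"
      using F(4) G(4) by (meson Int_mono subset_trans)
    with F(1-3) G(1-3) have "finite (F \<union> G) \<and> F \<union> G \<subseteq> P \<and> 0 < min e d \<and>
        ?N x (F \<union> G) (min e d) \<subseteq> U \<inter> V"
      by simp
    then show "\<exists>F e. finite F \<and> F \<subseteq> P \<and> 0 < e \<and> ?N x F e \<subseteq> U \<inter> V"
      by (intro exI[of _ "F \<union> G"] exI[of _ "min e d"])
  next
    fix U V
    assume "U \<subseteq> X \<and> (\<forall>x\<in>U. \<exists>F e. finite F \<and> F \<subseteq> P \<and> 0 < e \<and> ?N x F e \<subseteq> U)"
    then have "U \<subseteq> X" by (rule conjunct1)
    then show "U \<inter> V \<subseteq> X" by (rule le_infI1)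
  next
    fix K
    assume "\<forall>U\<in>K. U \<subseteq> X \<and> (\<forall>x\<in>U. \<exists>F e. finite F \<and> F \<subseteq> P \<and> 0 < e \<and> ?N x F e \<subseteq> U)"
    then show "\<Union>K \<subseteq> X" by (simp add: Sup_le_iff)
  next
    fix K x
    assume K: "\<forall>U\<in>K. U \<subseteq> X \<and> (\<forall>x\<in>U. \<exists>F e. finite F \<and> F \<subseteq> P \<and> 0 < e \<and> ?N x F e \<subseteq> U)"
      and x: "x \<in> \<Union>K"
    from x obtain U where UK: "U \<in> K" "x \<in> U" by (rule UnionE)
    with K have "\<exists>F e. finite F \<and> F \<subseteq> P \<and> 0 < e \<and> ?N x F e \<subseteq> U"
      by simp
    then obtain F e where "finite F" "F \<subseteq> P" "0 < e" "?N x F e \<subseteq> U"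
      by (elim exE conjE) (rule that)
    moreover have "U \<subseteq> \<Union>K"
      using UK(1) by (rule Union_upper)
    ultimately have "finite F \<and> F \<subseteq> P \<and> 0 < e \<and> ?N x F e \<subseteq> \<Union>K"
      by (intro conjI) (assumption | erule (1) subset_trans)+
    then show "\<exists>F e. finite F \<and> F \<subseteq> P \<and> 0 < e \<and> ?N x F e \<subseteq> \<Union>K"
      by (intro exI[of _ F] exI[of _ e])
  qed
  then show ?thesis
    unfolding seminorm_topology_def by (rule fun_cong[OF topology_inverse'])
qed

lemma topspace_seminorm_topology [simp]: "topspace (seminorm_topology X P) = X"
proof
  have "openin (seminorm_topology X P) X"
    unfolding openin_seminorm_topology
  proof (intro conjI ballI)
    fix x
    have "finite {} \<and> {} \<subseteq> P \<and> 0 < (1::real) \<and> {y\<in>X. \<forall>p\<in>{}. p (y - x) < 1} \<subseteq> X"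
      by simp
    then show "\<exists>F e. finite F \<and> F \<subseteq> P \<and> 0 < e \<and> {y\<in>X. \<forall>p\<in>F. p (y - x) < e} \<subseteq> X"
      by (intro exI[of _ "{}"] exI[of _ "1::real"])
  qed simp
  then show "X \<subseteq> topspace (seminorm_topology X P)"
    by (rule openin_subset)
  show "topspace (seminorm_topology X P) \<subseteq> X"
    using openin_topspace[of "seminorm_topology X P"]
    unfolding openin_seminorm_topology by (rule conjunct1)
qed

definition pre_Frechet ::
    "(complex \<Rightarrow> 'a::ab_group_add \<Rightarrow> 'a) \<Rightarrow> 'a set \<Rightarrow> 'a topology \<Rightarrow> bool" where
  "pre_Frechet s X T \<longleftrightarrow>
     vector_subspace s X \<and> Hausdorff_space T \<and>
     (\<exists>P. countable P \<and> (\<forall>p\<in>P. seminorm_on s X p) \<and> T = seminorm_topology X P)"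

definition linear_on ::
    "(complex \<Rightarrow> 'a::ab_group_add \<Rightarrow> 'a) \<Rightarrow> 'a set \<Rightarrow>
     (complex \<Rightarrow> 'b::ab_group_add \<Rightarrow> 'b) \<Rightarrow> 'b set \<Rightarrow> ('a \<Rightarrow> 'b) \<Rightarrow> bool" where
  "linear_on s X t Y f \<longleftrightarrow>
     vector_subspace s X \<and> vector_subspace t Y \<and> f ` X \<subseteq> Y \<and>
     (\<forall>x\<in>X. \<forall>y\<in>X. f (x + y) = f x + f y) \<and>
     (\<forall>c. \<forall>x\<in>X. f (s c x) = t c (f x))"

definition pre_Frechet_iso ::
    "(complex \<Rightarrow> 'a::ab_group_add \<Rightarrow> 'a) \<Rightarrow> 'a set \<Rightarrow> 'a topology \<Rightarrow>
     (complex \<Rightarrow> 'b::ab_group_add \<Rightarrow> 'b) \<Rightarrow> 'b set \<Rightarrow> 'b topology \<Rightarrow> ('a \<Rightarrow> 'b) \<Rightarrow> bool" where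
  "pre_Frechet_iso s X T t Y S f \<longleftrightarrow>
     pre_Frechet s X T \<and> pre_Frechet t Y S \<and>
     linear_on s X t Y f \<and> homeomorphic_map T S f"

definition bounded_operator ::
    "(complex \<Rightarrow> 'a::ab_group_add \<Rightarrow> 'a) \<Rightarrow> 'a set \<Rightarrow> ('a \<Rightarrow> real) \<Rightarrow>
     (complex \<Rightarrow> 'b::ab_group_add \<Rightarrow> 'b) \<Rightarrow> 'b set \<Rightarrow> ('b \<Rightarrow> real) \<Rightarrow> ('a \<Rightarrow> 'b) \<Rightarrow> bool" where
  "bounded_operator s X p t Y q f \<longleftrightarrow>
     norm_on s X p \<and> norm_on t Y q \<and> linear_on s X t Y f \<and>
     (\<exists>C. \<forall>x\<in>X. q (f x) \<le> C * p x)"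


section \<open>Local normed spaces and Schwartz spaces\<close>

text \<open>\<open>ker_coset X p x\<close> is the class of \<open>x\<close> in \<open>X / ker p\<close>; classes are represented as subsets of \<open>X\<close>.\<close>

definition ker_coset :: "'a::ab_group_add set \<Rightarrow> ('a \<Rightarrow> real) \<Rightarrow> 'a \<Rightarrow> 'a set" where
  "ker_coset X p x = {y\<in>X. p (y - x) = 0}"

definition local_space :: "'a::ab_group_add set \<Rightarrow> ('a \<Rightarrow> real) \<Rightarrow> 'a set set" where
  "local_space X p = ker_coset X p ` X"

definition local_norm :: "('a \<Rightarrow> real) \<Rightarrow> 'a set \<Rightarrow> real" where
  "local_norm p A = (INF x\<in>A. p x)"

text \<open>
  The norm of the difference of two classes. It is set to 0 off the quotient because the locale
  \<^locale>\<open>Metric_space\<close> asks for symmetry and non-negativity on the whole type.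
\<close>

definition local_dist :: "'a::ab_group_add set \<Rightarrow> ('a \<Rightarrow> real) \<Rightarrow> 'a set \<Rightarrow> 'a set \<Rightarrow> real" where
  "local_dist X p A B =
     (if A \<in> local_space X p \<and> B \<in> local_space X p
      then local_norm p {x - y | x y. x \<in> A \<and> y \<in> B} else 0)"

lemma vector_subspace_closed:
  assumes "vector_subspace s X"
  shows "0 \<in> X" "x \<in> X \<Longrightarrow> y \<in> X \<Longrightarrow> x + y \<in> X" "x \<in> X \<Longrightarrow> y \<in> X \<Longrightarrow> x - y \<in> X"
proof -
  interpret vector_space s using assms by (simp add: vector_subspace_def)
  have X: "subspace X" using assms by (simp add: vector_subspace_def)
  show "0 \<in> X" "x \<in> X \<Longrightarrow> y \<in> X \<Longrightarrow> x + y \<in> X" "x \<in> X \<Longrightarrow> y \<in> X \<Longrightarrow> x - y \<in> X"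
    by (rule subspace_0[OF X] subspace_add[OF X] subspace_diff[OF X]; assumption)+
qed

lemma seminorm_on_simps:
  assumes "seminorm_on s X p"
  shows "p 0 = 0" "x \<in> X \<Longrightarrow> y \<in> X \<Longrightarrow> p (x - y) = p (y - x)"
    "x \<in> X \<Longrightarrow> y \<in> X \<Longrightarrow> \<bar>p x - p y\<bar> \<le> p (x - y)"
proof -
  have V: "vector_subspace s X"
    and scale: "\<And>c x. x \<in> X \<Longrightarrow> p (s c x) = cmod c * p x"
    and add: "\<And>x y. x \<in> X \<Longrightarrow> y \<in> X \<Longrightarrow> p (x + y) \<le> p x + p y"
    using assms by (simp_all add: seminorm_on_def)
  interpret vector_space s using V by (simp add: vector_subspace_def)
  note closed = vector_subspace_closed[OF V]
  show "p 0 = 0" using scale[OF closed(1), of 0] by simp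
  have minus: "p (x - y) = p (y - x)" if "x \<in> X" "y \<in> X" for x y
    using scale[OF closed(3)[OF that(2,1)], of "-1"] by simp
  then show "x \<in> X \<Longrightarrow> y \<in> X \<Longrightarrow> p (x - y) = p (y - x)" .
  show "\<bar>p x - p y\<bar> \<le> p (x - y)" if "x \<in> X" "y \<in> X"
    using add[OF closed(3)[OF that] that(2)] add[OF closed(3)[OF that(2,1)] that(1)] minus[OF that]
    by simp
qed

lemma local_norm_ker_coset:
  assumes p: "seminorm_on s X p" and x: "x \<in> X"
  shows "local_norm p (ker_coset X p x) = p x"
proof -
  have "p y = p x" if "y \<in> ker_coset X p x" for y
    using seminorm_on_simps(3)[OF p _ x, of y] that by (simp add: ker_coset_def)
  moreover have "x \<in> ker_coset X p x"
    using x seminorm_on_simps(1)[OF p] by (simp add: ker_coset_def)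
  ultimately have "p ` ker_coset X p x = {p x}" by blast
  then show ?thesis by (simp add: local_norm_def)
qed

lemma local_dist_ker_coset:
  assumes p: "seminorm_on s X p" and x: "x \<in> X" and y: "y \<in> X"
  shows "local_dist X p (ker_coset X p x) (ker_coset X p y) = p (x - y)"
proof -
  have V: "vector_subspace s X"
    and add: "\<And>x y. x \<in> X \<Longrightarrow> y \<in> X \<Longrightarrow> p (x + y) \<le> p x + p y"
    using p by (simp_all add: seminorm_on_def)
  note closed = vector_subspace_closed[OF V]
  note simps = seminorm_on_simps[OF p]
  let ?S = "{u - v | u v. u \<in> ker_coset X p x \<and> v \<in> ker_coset X p y}"
  have "p (u - v) = p (x - y)" if "u \<in> ker_coset X p x" "v \<in> ker_coset X p y" for u v
  proof -
    have uv: "u \<in> X" "v \<in> X" "p (u - x) = 0" "p (v - y) = 0"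
      using that by (simp_all add: ker_coset_def)
    have "\<bar>p (u - v) - p (x - y)\<bar> \<le> p ((u - v) - (x - y))"
      using simps(3) closed(3) uv x y by simp
    also have "(u - v) - (x - y) = (u - x) + (y - v)" by simp
    also have "p \<dots> \<le> p (u - x) + p (y - v)"
      by (rule add[OF closed(3)[OF uv(1) x] closed(3)[OF y uv(2)]])
    also have "\<dots> = 0" using uv simps(2)[OF y uv(2)] by simp
    finally show ?thesis by simp
  qed
  then have "\<forall>w\<in>?S. p w = p (x - y)" by blast
  moreover have "x - y \<in> ?S"
  proof -
    have "x \<in> ker_coset X p x" "y \<in> ker_coset X p y"
      using x y simps(1) by (simp_all add: ker_coset_def)
    then show ?thesis by blast
  qed
  ultimately have "p ` ?S = {p (x - y)}" by blast
  then show ?thesis using x y by (simp add: local_dist_def local_norm_def local_space_def)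
qed

lemma Metric_space_local_space:
  assumes p: "seminorm_on s X p"
  shows "Metric_space (local_space X p) (local_dist X p)"
proof -
  have V: "vector_subspace s X"
    and pos: "\<And>x. x \<in> X \<Longrightarrow> 0 \<le> p x"
    and add: "\<And>x y. x \<in> X \<Longrightarrow> y \<in> X \<Longrightarrow> p (x + y) \<le> p x + p y"
    using p by (simp_all add: seminorm_on_def)
  note closed = vector_subspace_closed[OF V]
  note simps = seminorm_on_simps[OF p]
  note dist = local_dist_ker_coset[OF p]
  have off: "local_dist X p A B = 0" if "\<not> (A \<in> local_space X p \<and> B \<in> local_space X p)" for A B
    using that by (auto simp: local_dist_def)
  have triangle: "p (x - z) \<le> p (x - y) + p (y - z)" if "x \<in> X" "y \<in> X" "z \<in> X" for x y z
    using add[OF closed(3)[OF that(1,2)] closed(3)[OF that(2,3)]] by simp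
  show ?thesis
  proof
    fix A B
    show "0 \<le> local_dist X p A B"
    proof (cases "A \<in> local_space X p \<and> B \<in> local_space X p")
      case True
      then obtain x y where "x \<in> X" "A = ker_coset X p x" "y \<in> X" "B = ker_coset X p y"
        by (auto simp: local_space_def)
      then show ?thesis using dist pos closed(3) by simp
    qed (simp add: off)
    show "local_dist X p A B = local_dist X p B A"
    proof (cases "A \<in> local_space X p \<and> B \<in> local_space X p")
      case True
      then obtain x y where "x \<in> X" "A = ker_coset X p x" "y \<in> X" "B = ker_coset X p y"
        by (auto simp: local_space_def)
      then show ?thesis using dist simps(2) by simp
    next
      case False
      then have "\<not> (B \<in> local_space X p \<and> A \<in> local_space X p)" by blast
      then show ?thesis using off[OF False] off by simp
    qed
  next
    fix A B assume "A \<in> local_space X p" "B \<in> local_space X p"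
    then obtain x y where x: "x \<in> X" "A = ker_coset X p x" and y: "y \<in> X" "B = ker_coset X p y"
      by (auto simp: local_space_def)
    have "p (x - y) = 0 \<longleftrightarrow> ker_coset X p x = ker_coset X p y"
    proof
      assume eq: "p (x - y) = 0"
      have "p (z - x) = 0 \<longleftrightarrow> p (z - y) = 0" if "z \<in> X" for z
        using triangle[OF that x(1) y(1)] triangle[OF that y(1) x(1)] eq simps(2)[OF x(1) y(1)]
          pos[OF closed(3)[OF that x(1)]] pos[OF closed(3)[OF that y(1)]] by linarith
      then show "ker_coset X p x = ker_coset X p y" by (auto simp: ker_coset_def)
    next
      assume "ker_coset X p x = ker_coset X p y"
      moreover have "x \<in> ker_coset X p x" using x(1) simps(1) by (simp add: ker_coset_def)
      ultimately show "p (x - y) = 0" by (simp add: ker_coset_def)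
    qed
    then show "local_dist X p A B = 0 \<longleftrightarrow> A = B" using x y dist by simp
  next
    fix A B C
    assume "A \<in> local_space X p" "B \<in> local_space X p" "C \<in> local_space X p"
    then obtain x y z where "x \<in> X" "A = ker_coset X p x" "y \<in> X" "B = ker_coset X p y"
      "z \<in> X" "C = ker_coset X p z"
      by (auto simp: local_space_def)
    then show "local_dist X p A C \<le> local_dist X p A B + local_dist X p B C"
      using dist triangle by simp
  qed
qed

text \<open>
  The canonical map \<open>X / ker p \<rightarrow> X / ker q\<close>, which sends the class of \<open>x\<close> to the class of \<open>x\<close> if
  \<open>q \<le> c p\<close> on \<open>X\<close>.
\<close>

definition canonical_map :: "'a::ab_group_add set \<Rightarrow> ('a \<Rightarrow> real) \<Rightarrow> 'a set \<Rightarrow> 'a set" where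
  "canonical_map X q A = (\<Union>x\<in>A. ker_coset X q x)"

definition canonical_map_precompact ::
    "'a::ab_group_add set \<Rightarrow> ('a \<Rightarrow> real) \<Rightarrow> ('a \<Rightarrow> real) \<Rightarrow> bool" where
  "canonical_map_precompact X p q \<longleftrightarrow>
     Metric_space.mtotally_bounded (local_space X q) (local_dist X q)
       (canonical_map X q ` {A \<in> local_space X p. local_norm p A \<le> 1})"

definition Schwartz_system ::
    "(complex \<Rightarrow> 'a::ab_group_add \<Rightarrow> 'a) \<Rightarrow> 'a set \<Rightarrow> ('a \<Rightarrow> real) set \<Rightarrow> bool" where
  "Schwartz_system s X P \<longleftrightarrow>
     P \<noteq> {} \<and> (\<forall>p\<in>P. seminorm_on s X p) \<and>
     (\<forall>p\<in>P. \<forall>q\<in>P. \<exists>r\<in>P. \<forall>x\<in>X. p x \<le> r x \<and> q x \<le> r x) \<and>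
     (\<forall>q\<in>P. \<exists>p\<in>P. \<exists>c>0. (\<forall>x\<in>X. q x \<le> c * p x) \<and> canonical_map_precompact X p q)"


section \<open>Projective limits of sequences of normed spaces\<close>

definition projective_spectrum ::
    "(complex \<Rightarrow> 'a::ab_group_add \<Rightarrow> 'a) \<Rightarrow> (nat \<Rightarrow> 'a set) \<Rightarrow> (nat \<Rightarrow> 'a \<Rightarrow> real) \<Rightarrow>
     (nat \<Rightarrow> 'a \<Rightarrow> 'a) \<Rightarrow> bool" where
  "projective_spectrum s X p j \<longleftrightarrow>
     (\<forall>k. norm_on s (X k) (p k) \<and>
          bounded_operator s (X (Suc k)) (p (Suc k)) s (X k) (p k) (j k))"

definition proj_space :: "(nat \<Rightarrow> 'a set) \<Rightarrow> (nat \<Rightarrow> 'a \<Rightarrow> 'a) \<Rightarrow> (nat \<Rightarrow> 'a) set" where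
  "proj_space X j = {x. \<forall>k. x k \<in> X k \<and> j k (x (Suc k)) = x k}"

definition proj_topology ::
    "(nat \<Rightarrow> 'a::ab_group_add set) \<Rightarrow> (nat \<Rightarrow> 'a \<Rightarrow> real) \<Rightarrow> (nat \<Rightarrow> 'a \<Rightarrow> 'a) \<Rightarrow> (nat \<Rightarrow> 'a) topology" where
  "proj_topology X p j =
     subtopology (product_topology (\<lambda>k. seminorm_topology (X k) {p k}) UNIV) (proj_space X j)"

definition pointwise_scale :: "(complex \<Rightarrow> 'a \<Rightarrow> 'a) \<Rightarrow> complex \<Rightarrow> (nat \<Rightarrow> 'a) \<Rightarrow> nat \<Rightarrow> 'a" where
  "pointwise_scale s c x = (\<lambda>k. s c (x k))"


section \<open>General Dirichlet series\<close>

text \<open>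
  A frequency and the coefficients of a Dirichlet series are indexed from 0, i.e. \<open>lam n\<close> and \<open>a n\<close>
  are the \<open>(n+1)\<close>-st frequency and coefficient. A formal \<open>lam\<close>-Dirichlet series is
  identified with its sequence of coefficients.
\<close>

definition frequency :: "(nat \<Rightarrow> real) \<Rightarrow> bool" where
  "frequency lam \<longleftrightarrow> strict_mono lam \<and> (\<forall>n. 0 \<le> lam n) \<and> \<not> bdd_above (range lam)"

type_synonym dseries = "nat \<Rightarrow> complex"

definition ds_scale :: "complex \<Rightarrow> dseries \<Rightarrow> dseries" where
  "ds_scale = pointwise_scale (*)"

definition right_half_plane :: "real \<Rightarrow> complex set" where
  "right_half_plane \<sigma> = {s. \<sigma> < Re s}"

definition ds_term :: "(nat \<Rightarrow> real) \<Rightarrow> dseries \<Rightarrow> complex \<Rightarrow> nat \<Rightarrow> complex" where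
  "ds_term lam a s n = a n * exp (- (of_real (lam n) * s))"

definition ds_fun :: "(nat \<Rightarrow> real) \<Rightarrow> dseries \<Rightarrow> complex \<Rightarrow> complex" where
  "ds_fun lam a s = (\<Sum>n. ds_term lam a s n)"

definition ds_converges :: "(nat \<Rightarrow> real) \<Rightarrow> dseries \<Rightarrow> bool" where
  "ds_converges lam a \<longleftrightarrow> (\<forall>s\<in>right_half_plane 0. summable (ds_term lam a s))"

definition ds_shift :: "(nat \<Rightarrow> real) \<Rightarrow> real \<Rightarrow> dseries \<Rightarrow> dseries" where
  "ds_shift lam \<sigma> a = (\<lambda>n. a n * exp (- (of_real (lam n) * of_real \<sigma>)))"

definition D_inf :: "(nat \<Rightarrow> real) \<Rightarrow> dseries set" where
  "D_inf lam = {a. ds_converges lam a \<and> bounded (ds_fun lam a ` right_half_plane 0)}"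

definition norm_inf :: "(nat \<Rightarrow> real) \<Rightarrow> dseries \<Rightarrow> real" where
  "norm_inf lam a = (SUP s\<in>right_half_plane 0. cmod (ds_fun lam a s))"

definition D_inf_plus :: "(nat \<Rightarrow> real) \<Rightarrow> dseries set" where
  "D_inf_plus lam =
     {a. ds_converges lam a \<and> (\<forall>\<sigma>>0. bounded (ds_fun lam a ` right_half_plane \<sigma>))}"

text \<open>The spaces \<open>D_inf_k lam k\<close> and the norms \<open>norm_k lam k\<close> are meant for \<open>k \<ge> 1\<close> only.\<close>

definition norm_k :: "(nat \<Rightarrow> real) \<Rightarrow> nat \<Rightarrow> dseries \<Rightarrow> real" where
  "norm_k lam k a = norm_inf lam (ds_shift lam (1 / real k) a)"

definition D_inf_k :: "(nat \<Rightarrow> real) \<Rightarrow> nat \<Rightarrow> dseries set" where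
  "D_inf_k lam k = {a. ds_shift lam (1 / real k) a \<in> D_inf lam}"

definition D_inf_plus_norms :: "(nat \<Rightarrow> real) \<Rightarrow> (dseries \<Rightarrow> real) set" where
  "D_inf_plus_norms lam = norm_k lam ` {1..}"

definition D_inf_plus_topology :: "(nat \<Rightarrow> real) \<Rightarrow> dseries topology" where
  "D_inf_plus_topology lam = seminorm_topology (D_inf_plus lam) (D_inf_plus_norms lam)"

definition inj_map :: "nat \<Rightarrow> dseries \<Rightarrow> dseries" where
  "inj_map k a = a"

definition tau_map :: "(nat \<Rightarrow> real) \<Rightarrow> nat \<Rightarrow> dseries \<Rightarrow> dseries" where
  "tau_map lam k = ds_shift lam (1 / real k - 1 / real (Suc k))"

text \<open>
  Projective spectra are indexed by all natural numbers, so the members with index \<open>k \<ge> 1\<close> in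
  the usual numbering appear at position \<open>k - 1\<close>; whence the occurrences of \<^const>\<open>Suc\<close>.
\<close>

abbreviation spaces1 :: "(nat \<Rightarrow> real) \<Rightarrow> nat \<Rightarrow> dseries set" where
  "spaces1 lam \<equiv> (\<lambda>k. D_inf_k lam (Suc k))"

abbreviation norms1 :: "(nat \<Rightarrow> real) \<Rightarrow> nat \<Rightarrow> dseries \<Rightarrow> real" where
  "norms1 lam \<equiv> (\<lambda>k. norm_k lam (Suc k))"

abbreviation maps1 :: "nat \<Rightarrow> dseries \<Rightarrow> dseries" where
  "maps1 \<equiv> (\<lambda>k. inj_map (Suc k))"

abbreviation spaces2 :: "(nat \<Rightarrow> real) \<Rightarrow> nat \<Rightarrow> dseries set" where
  "spaces2 lam \<equiv> (\<lambda>k. D_inf lam)"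

abbreviation norms2 :: "(nat \<Rightarrow> real) \<Rightarrow> nat \<Rightarrow> dseries \<Rightarrow> real" where
  "norms2 lam \<equiv> (\<lambda>k. norm_inf lam)"

abbreviation maps2 :: "(nat \<Rightarrow> real) \<Rightarrow> nat \<Rightarrow> dseries \<Rightarrow> dseries" where
  "maps2 lam \<equiv> (\<lambda>k. tau_map lam (Suc k))"

end

theory Submission
  imports Defs "HOL-Complex_Analysis.Complex_Analysis"
begin

text \<open>
  The substance is that every translation \<open>D \<mapsto> D\<^sub>\<sigma>\<close> with \<open>\<sigma> > 0\<close> maps the unit ball of
  \<open>\<D>\<^sub>\<infinity>(\<lambda>)\<close> to a precompact set (lemma \<open>precompact_translation\<close>), and that \<open>\<parallel>\<cdot>\<parallel>\<^sub>\<infinity>\<close> is a norm. The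
  Schwartz property is the first fact with \<open>\<sigma> = 1/k - 1/(k+1)\<close>, because \<open>\<parallel>D\<parallel>\<^sub>k\<close> is the norm of the
  translate by \<open>\<sigma>\<close> of \<open>D\<^bsub>1/(k+1)\<^esub>\<close>. The two projective representations are formal.

  Both facts come from one approximation, \<open>translate_approx_Dirichlet_polynomial\<close>. No half-plane of
  absolute or uniform convergence is available for a general frequency, so a series cannot simply
  be truncated. Instead put \<open>c = \<sigma>/2\<close> and integrate \<open>f(s + z)\<close>, where \<open>f\<close> is the sum of \<open>D\<close>, over
  the line \<open>Re z = c\<close> against \<open>\<sigma>\<^sup>2/(2\<pi>) e\<^bsup>-N(\<sigma> - z)\<^esup> / ((\<sigma> - z) z\<^sup>2)\<close>. The modulus of this
  kernel has integral at most \<open>2 e\<^bsup>-N\<sigma>/2\<^esup>\<close>, so the result has norm at most \<open>2 e\<^bsup>-N\<sigma>/2\<^esup> \<parallel>D\<parallel>\<^sub>\<infinity>\<close>. On the other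
  hand the term \<open>e\<^bsup>-\<lambda>\<^sub>n(s + z)\<^esup>\<close> with \<open>\<lambda>\<^sub>n \<ge> N\<close> is turned into \<open>e\<^bsup>-\<lambda>\<^sub>n(s + \<sigma>)\<^esup>\<close>: the contour may be closed
  in the right half-plane, where \<open>\<sigma>\<close> is the only pole. Hence \<open>D\<^sub>\<sigma>\<close> differs from the transformed
  series only in the finitely many terms with \<open>\<lambda>\<^sub>n < N\<close>, that is, \<open>D\<^sub>\<sigma>\<close> is a Dirichlet polynomial up to
  an error of norm \<open>2 e\<^bsup>-N\<sigma>/2\<^esup> \<parallel>D\<parallel>\<^sub>\<infinity>\<close>. The series may be integrated term by term because, by Abel
  summation, its partial sums grow at most linearly along the line, while the kernel decays like
  \<open>|z|\<^bsup>-3\<^esup>\<close>.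

  The polynomial has the coefficients of \<open>D\<close> multiplied by weights that do not depend on \<open>D\<close>. With
  \<open>\<sigma>\<close> large and \<open>N = \<lambda>\<^bsub>n+1\<^esub>\<close> the \<open>n\<close>-th weight is nonzero, and induction on \<open>n\<close> bounds the \<open>n\<close>-th
  coefficient of \<open>D\<close> by a multiple of \<open>\<parallel>D\<parallel>\<^sub>\<infinity>\<close> (lemma \<open>coefficient_bound\<close>); in particular
  \<open>\<parallel>D\<parallel>\<^sub>\<infinity> = 0\<close> only for \<open>D = 0\<close>. With \<open>\<sigma>\<close> fixed and \<open>N\<close> large, the approximation reduces precompactness
  to that of a bounded set of finitely many coefficients.
\<close>

section \<open>Topologies given by sequences of seminorms\<close>

lemma vector_space_pointwise_scale:
  assumes "vector_space s"
  shows "vector_space (pointwise_scale s)"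
proof -
  interpret vector_space s by (rule assms)
  show ?thesis
    by standard (simp_all add: pointwise_scale_def fun_eq_iff scale_right_distrib scale_left_distrib)
qed

lemma vector_subspaceI:
  assumes "vector_space s" "0 \<in> X"
    and "\<And>x y. x \<in> X \<Longrightarrow> y \<in> X \<Longrightarrow> x + y \<in> X"
    and "\<And>c x. x \<in> X \<Longrightarrow> s c x \<in> X"
  shows "vector_subspace s X"
proof -
  interpret vector_space s by (rule assms)
  show ?thesis
    using assms unfolding vector_subspace_def by (auto intro!: subspaceI)
qed

lemma vector_subspace_scale:
  assumes "vector_subspace s X" "x \<in> X"
  shows "s c x \<in> X"
proof -
  interpret vector_space s using assms by (simp add: vector_subspace_def)
  show ?thesis using assms by (auto simp: vector_subspace_def subspace_scale)
qed

lemma linear_on_diff: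
  assumes "linear_on s X t Y f" "x \<in> X" "y \<in> X"
  shows "f (x - y) = f x - f y"
proof -
  have "vector_subspace s X" and add: "\<And>x y. x \<in> X \<Longrightarrow> y \<in> X \<Longrightarrow> f (x + y) = f x + f y"
    using assms(1) by (auto simp: linear_on_def)
  then have "x - y \<in> X" using vector_subspace_closed(3) assms by blast
  then have "f (x - y) + f y = f x" using add[of "x - y" y] assms by simp
  then show ?thesis by (simp add: eq_diff_eq)
qed

text \<open>
  Indexing the seminorms makes a finite set of them a finite set of indices, which is the form in
  which neighbourhoods in a product space are given.
\<close>
lemma openin_seminorm_topology_range:
  "openin (seminorm_topology X (range p)) U \<longleftrightarrow> U \<subseteq> X \<and>
     (\<forall>x\<in>U. \<exists>F e. finite F \<and> 0 < e \<and> {y\<in>X. \<forall>k\<in>F. p k (y - x) < e} \<subseteq> U)"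
    (is "_ \<longleftrightarrow> _ \<and> (\<forall>x\<in>U. ?R x)")
proof -
  have "(\<exists>F e. finite F \<and> F \<subseteq> range p \<and> 0 < e \<and> {y\<in>X. \<forall>q\<in>F. q (y - x) < e} \<subseteq> U) \<longleftrightarrow> ?R x"
    (is "?L x \<longleftrightarrow> _") for x
  proof
    assume "?L x"
    then obtain F e where F: "finite F" "F \<subseteq> range p" "0 < e"
      "{y\<in>X. \<forall>q\<in>F. q (y - x) < e} \<subseteq> U" by blast
    then obtain G where "finite G" "F = p ` G" by (meson finite_subset_image subset_UNIV)
    with F show "?R x" by (intro exI[of _ G] exI[of _ e]) auto
  next
    assume "?R x"
    then obtain F e where "finite F" "0 < e" "{y\<in>X. \<forall>k\<in>F. p k (y - x) < e} \<subseteq> U" by blast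
    then show "?L x" by (intro exI[of _ "p ` F"] exI[of _ e]) auto
  qed
  then show ?thesis unfolding openin_seminorm_topology by simp
qed

lemma openin_seminorm_ball:
  assumes p: "seminorm_on s X p" and P: "p \<in> P" and x: "x \<in> X"
  shows "openin (seminorm_topology X P) {y\<in>X. p (y - x) < e}"
  unfolding openin_seminorm_topology
proof (intro conjI ballI)
  have V: "vector_subspace s X"
    and add: "\<And>x y. x \<in> X \<Longrightarrow> y \<in> X \<Longrightarrow> p (x + y) \<le> p x + p y"
    using p by (simp_all add: seminorm_on_def)
  note diff = vector_subspace_closed(3)[OF V]
  fix z assume z: "z \<in> {y\<in>X. p (y - x) < e}"
  have "p (y - x) < e" if "y \<in> X" "p (y - z) < e - p (z - x)" for y
    using add[OF diff[OF that(1)] diff[OF _ x], of z z] z that by simp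
  then show "\<exists>F d. finite F \<and> F \<subseteq> P \<and> 0 < d \<and> {y\<in>X. \<forall>q\<in>F. q (y - z) < d} \<subseteq> {y\<in>X. p (y - x) < e}"
    using z P by (intro exI[of _ "{p}"] exI[of _ "e - p (z - x)"]) auto
qed auto

lemma Hausdorff_seminorm_topology:
  assumes V: "vector_subspace s X" and P: "\<And>p. p \<in> P \<Longrightarrow> seminorm_on s X p"
    and sep: "\<And>x. x \<in> X \<Longrightarrow> x \<noteq> 0 \<Longrightarrow> \<exists>p\<in>P. p x \<noteq> 0"
  shows "Hausdorff_space (seminorm_topology X P)"
  unfolding Hausdorff_space_def topspace_seminorm_topology
proof (intro allI impI)
  fix x y assume xy: "x \<in> X \<and> y \<in> X \<and> x \<noteq> y"
  note diff = vector_subspace_closed(3)[OF V]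
  obtain p where p: "p \<in> P" "p (x - y) \<noteq> 0" using sep[of "x - y"] xy diff by auto
  note sp = P[OF p(1)]
  have pos: "p (x - y) > 0"
    using p(2) sp xy diff[of x y] by (force simp: seminorm_on_def)
  define d where "d = p (x - y) / 2"
  have "disjnt {z\<in>X. p (z - x) < d} {z\<in>X. p (z - y) < d}"
    unfolding disjnt_iff
  proof (intro allI notI)
    fix z assume z: "z \<in> {z\<in>X. p (z - x) < d} \<and> z \<in> {z\<in>X. p (z - y) < d}"
    have "p ((x - z) + (z - y)) \<le> p (x - z) + p (z - y)"
      using sp xy z diff[of x z] diff[of z y] unfolding seminorm_on_def by blast
    then show False
      using z seminorm_on_simps(2)[OF sp, of x z] xy by (auto simp: d_def)
  qed
  moreover have "x \<in> {z\<in>X. p (z - x) < d}" "y \<in> {z\<in>X. p (z - y) < d}"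
    using xy pos seminorm_on_simps(1)[OF sp] by (auto simp: d_def)
  ultimately show "\<exists>U V. openin (seminorm_topology X P) U \<and> openin (seminorm_topology X P) V \<and>
      x \<in> U \<and> y \<in> V \<and> disjnt U V"
    using openin_seminorm_ball[OF sp p(1)] xy by meson
qed

lemma pre_Frechet_seminorm_topology:
  fixes p :: "nat \<Rightarrow> 'a::ab_group_add \<Rightarrow> real"
  assumes V: "vector_subspace s X" and p: "\<And>k. seminorm_on s X (p k)"
    and sep: "\<And>x. x \<in> X \<Longrightarrow> x \<noteq> 0 \<Longrightarrow> \<exists>k. p k x \<noteq> 0"
  shows "pre_Frechet s X (seminorm_topology X (range p))"
  unfolding pre_Frechet_def
proof (intro conjI exI[of _ "range p"])
  show "Hausdorff_space (seminorm_topology X (range p))"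
    by (rule Hausdorff_seminorm_topology[OF V]) (use p sep in auto)
qed (use V p in auto)

text \<open>
  A linear bijection that carries one sequence of seminorms to the other maps basic neighbourhoods
  onto basic neighbourhoods.
\<close>
lemma homeomorphic_map_seminorm_topology:
  assumes bij: "bij_betw f X Y" and V: "vector_subspace s X"
    and diff: "\<And>x y. x \<in> X \<Longrightarrow> y \<in> X \<Longrightarrow> f (x - y) = f x - f y"
    and norm: "\<And>k x. x \<in> X \<Longrightarrow> q k (f x) = p k x"
  shows "homeomorphic_map (seminorm_topology X (range p)) (seminorm_topology Y (range q)) f"
proof -
  have fX: "f ` X = Y" and inj: "inj_on f X" using bij by (auto simp: bij_betw_def)
  have ball: "f ` {y\<in>X. \<forall>k\<in>F. p k (y - x) < e} = {y\<in>Y. \<forall>k\<in>F. q k (y - f x) < e}"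
    if "x \<in> X" for x F and e :: real
  proof -
    have "p k (y - x) = q k (f y - f x)" if "y \<in> X" for y k
      using that \<open>x \<in> X\<close> norm vector_subspace_closed(3)[OF V] diff by metis
    then show ?thesis using fX by force
  qed
  have "openin (seminorm_topology Y (range q)) (f ` U) \<longleftrightarrow> openin (seminorm_topology X (range p)) U"
    if U: "U \<subseteq> X" for U
  proof -
    have "{y\<in>Y. \<forall>k\<in>F. q k (y - f x) < e} \<subseteq> f ` U \<longleftrightarrow> {y\<in>X. \<forall>k\<in>F. p k (y - x) < e} \<subseteq> U"
      if "x \<in> U" for x F and e :: real
    proof -
      have "x \<in> X" using that U by auto
      then show ?thesis
        unfolding ball[OF \<open>x \<in> X\<close>, symmetric] using inj U by (intro inj_on_image_subset_iff) auto
    qed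
    then show ?thesis using U fX by (auto simp: openin_seminorm_topology_range)
  qed
  note img = this
  show ?thesis
    unfolding homeomorphic_map_def
  proof
    show "inj_on f (topspace (seminorm_topology X (range p)))" using inj by simp
    show "quotient_map (seminorm_topology X (range p)) (seminorm_topology Y (range q)) f"
      unfolding quotient_map_def topspace_seminorm_topology
    proof (intro conjI allI impI fX)
      fix W assume "W \<subseteq> Y"
      then have "f ` {x\<in>X. f x \<in> W} = W" using fX by auto
      then show "openin (seminorm_topology X (range p)) {x\<in>X. f x \<in> W} =
          openin (seminorm_topology Y (range q)) W"
        using img[of "{x\<in>X. f x \<in> W}"] by auto
    qed
  qed
qed

section \<open>Projective limits as seminormed spaces\<close>

lemma vector_subspace_proj_space:
  assumes "projective_spectrum s X p j"
  shows "vector_subspace (pointwise_scale s) (proj_space X j)"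
proof -
  have V: "vector_subspace s (X k)" and lin: "linear_on s (X (Suc k)) s (X k) (j k)" for k
    using assms by (auto simp: projective_spectrum_def bounded_operator_def linear_on_def)
  have j_add: "j k (x + y) = j k x + j k y" if "x \<in> X (Suc k)" "y \<in> X (Suc k)" for k x y
    using lin[of k] that by (auto simp: linear_on_def)
  have j_scale: "j k (s c x) = s c (j k x)" if "x \<in> X (Suc k)" for k x c
    using lin[of k] that by (auto simp: linear_on_def)
  have 0: "j k 0 = 0" for k
    using j_add[of 0 k 0] vector_subspace_closed(1)[OF V] by simp
  show ?thesis
  proof (rule vector_subspaceI)
    show "vector_space (pointwise_scale s)"
      using V[of 0] vector_space_pointwise_scale by (auto simp: vector_subspace_def)
  qed (auto simp: proj_space_def 0 j_add j_scale pointwise_scale_def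
      intro: vector_subspace_closed[OF V] vector_subspace_scale[OF V])
qed

lemma seminorm_on_proj_space:
  assumes "projective_spectrum s X p j"
  shows "seminorm_on (pointwise_scale s) (proj_space X j) (\<lambda>x. p k (x k))"
proof -
  have "seminorm_on s (X k) (p k)"
    using assms by (auto simp: projective_spectrum_def norm_on_def)
  then show ?thesis
    using vector_subspace_proj_space[OF assms]
    by (auto simp: seminorm_on_def proj_space_def pointwise_scale_def)
qed

text \<open>
  A product neighbourhood restricts finitely many coordinates. So the projective limit carries the
  topology of the seminorms \<open>x \<mapsto> p k (x k)\<close>, and pre-Frechet spaces can be recognised and compared
  through their seminorms alone.
\<close>
lemma proj_topology_eq_seminorm_topology:
  assumes "projective_spectrum s X p j"
  shows "proj_topology X p j = seminorm_topology (proj_space X j) (range (\<lambda>k x. p k (x k)))"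
proof (rule topology_eq[THEN iffD2], intro allI)
  have sn: "seminorm_on s (X k) (p k)" for k
    using assms by (auto simp: projective_spectrum_def norm_on_def)
  let ?S = "proj_space X j"
  let ?T = "\<lambda>k. seminorm_topology (X k) {p k}"
  fix U
  show "openin (proj_topology X p j) U \<longleftrightarrow> openin (seminorm_topology ?S (range (\<lambda>k x. p k (x k)))) U"
  proof
    assume "openin (proj_topology X p j) U"
    then obtain V where V: "openin (product_topology ?T UNIV) V" "U = V \<inter> ?S"
      unfolding proj_topology_def openin_subtopology by blast
    show "openin (seminorm_topology ?S (range (\<lambda>k x. p k (x k)))) U"
      unfolding openin_seminorm_topology_range
    proof (intro conjI ballI)
      fix x assume x: "x \<in> U"
      with V obtain W where W: "finite {k. W k \<noteq> X k}" "\<And>k. openin (?T k) (W k)"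
        "x \<in> Pi\<^sub>E UNIV W" "Pi\<^sub>E UNIV W \<subseteq> V"
        unfolding openin_product_topology_alt by force
      have "\<exists>e>0. {y\<in>X k. p k (y - x k) < e} \<subseteq> W k" for k
      proof -
        have "x k \<in> W k" using W(3) by auto
        then obtain F e where F: "F \<subseteq> {p k}" "0 < e" "{y\<in>X k. \<forall>q\<in>F. q (y - x k) < e} \<subseteq> W k"
          using W(2)[of k] unfolding openin_seminorm_topology by blast
        then show ?thesis by (intro exI[of _ e]) auto
      qed
      then obtain e where e: "\<And>k. 0 < e k" "\<And>k. {y\<in>X k. p k (y - x k) < e k} \<subseteq> W k"
        by metis
      let ?F = "{k. W k \<noteq> X k}"
      \<comment> \<open>The inserted \<open>1\<close> covers the case that no coordinate is restricted.\<close>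
  define d where "d = Min (insert 1 (e ` ?F))"
      have d: "0 < d" "\<And>k. k \<in> ?F \<Longrightarrow> d \<le> e k"
        using W(1) e(1) by (auto simp: d_def)
      have "{y\<in>?S. \<forall>k\<in>?F. p k ((y - x) k) < d} \<subseteq> U"
      proof
        fix y assume y: "y \<in> {y\<in>?S. \<forall>k\<in>?F. p k ((y - x) k) < d}"
        have "y k \<in> W k" for k
        proof (cases "k \<in> ?F")
          case True
          then have "p k (y k - x k) < e k" using y d(2)[of k] by fastforce
          then show ?thesis using e(2)[of k] y by (auto simp: proj_space_def)
        qed (use y in \<open>auto simp: proj_space_def\<close>)
        then show "y \<in> U" using W(4) y V(2) by auto
      qed
      then show "\<exists>F e. finite F \<and> 0 < e \<and> {y\<in>?S. \<forall>k\<in>F. p k ((y - x) k) < e} \<subseteq> U"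
        using W(1) d(1) by blast
    qed (use V in auto)
  next
    assume U: "openin (seminorm_topology ?S (range (\<lambda>k x. p k (x k)))) U"
    show "openin (proj_topology X p j) U"
    proof (subst openin_subopen, intro ballI)
      fix x assume x: "x \<in> U"
      then obtain F e where F: "finite F" "0 < e" "{y\<in>?S. \<forall>k\<in>F. p k ((y - x) k) < e} \<subseteq> U"
        and xS: "x \<in> ?S"
        using U unfolding openin_seminorm_topology_range by blast
      define W where "W k = (if k \<in> F then {y\<in>X k. p k (y - x k) < e} else X k)" for k
      have xX: "x k \<in> X k" for k using xS by (auto simp: proj_space_def)
      have "openin (?T k) (W k)" for k
        using openin_seminorm_ball[OF sn _ xX[of k], of "{p k}" e]
          openin_topspace[of "?T k"] by (auto simp: W_def)
      moreover have "finite {k. W k \<noteq> topspace (?T k)}"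
        by (rule finite_subset[OF _ F(1)]) (auto simp: W_def)
      ultimately have "openin (product_topology ?T UNIV) (Pi\<^sub>E UNIV W)"
        by (subst openin_PiE_gen) auto
      then have "openin (proj_topology X p j) (Pi\<^sub>E UNIV W \<inter> ?S)"
        unfolding proj_topology_def openin_subtopology by blast
      moreover have "x \<in> Pi\<^sub>E UNIV W \<inter> ?S"
        using xS xX F(2) seminorm_on_simps(1)[OF sn] by (auto simp: W_def)
      moreover have "Pi\<^sub>E UNIV W \<inter> ?S \<subseteq> U"
      proof
        fix y assume y: "y \<in> Pi\<^sub>E UNIV W \<inter> ?S"
        have "p k (y k - x k) < e" if "k \<in> F" for k
        proof -
          have "y k \<in> W k" using y by auto
          then show ?thesis using that by (simp add: W_def)
        qed
        then show "y \<in> U" using y F(3) by auto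
      qed
      ultimately show "\<exists>V. openin (proj_topology X p j) V \<and> x \<in> V \<and> V \<subseteq> U" by blast
    qed
  qed
qed

lemma pre_Frechet_proj:
  assumes "projective_spectrum s X p j"
  shows "pre_Frechet (pointwise_scale s) (proj_space X j) (proj_topology X p j)"
  unfolding proj_topology_eq_seminorm_topology[OF assms]
proof (rule pre_Frechet_seminorm_topology)
  fix x assume "x \<in> proj_space X j" "x \<noteq> 0"
  then obtain k where "x k \<noteq> 0" "x k \<in> X k" by (auto simp: fun_eq_iff proj_space_def)
  then show "\<exists>k. p k (x k) \<noteq> 0"
    using assms by (auto simp: projective_spectrum_def norm_on_def)
qed (use assms in \<open>auto intro: vector_subspace_proj_space seminorm_on_proj_space\<close>)

text \<open>
  Both representations of the theorem are instances: for either of them, the norm of the \<open>k\<close>-th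
  coordinate of the image of \<open>D\<close> is the \<open>k\<close>-th norm of \<open>D\<close>.
\<close>
lemma pre_Frechet_iso_proj:
  assumes E: "pre_Frechet s E (seminorm_topology E (range q))"
    and spec: "projective_spectrum t X p j"
    and lin: "linear_on s E (pointwise_scale t) (proj_space X j) f"
    and bij: "bij_betw f E (proj_space X j)"
    and norm: "\<And>k x. x \<in> E \<Longrightarrow> p k (f x k) = q k x"
  shows "pre_Frechet_iso s E (seminorm_topology E (range q))
    (pointwise_scale t) (proj_space X j) (proj_topology X p j) f"
  unfolding pre_Frechet_iso_def
proof (intro conjI E lin pre_Frechet_proj[OF spec])
  show "homeomorphic_map (seminorm_topology E (range q)) (proj_topology X p j) f"
    unfolding proj_topology_eq_seminorm_topology[OF spec]
    by (rule homeomorphic_map_seminorm_topology[where q = "\<lambda>k x. p k (x k)",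
          OF bij _ linear_on_diff[OF lin] norm])
      (use lin in \<open>auto simp: linear_on_def\<close>)
qed

section \<open>Precompactness of canonical maps\<close>

text \<open>
  The canonical map was defined as a union of classes; as \<open>q\<close> is dominated by \<open>p\<close>, all the classes
  in that union coincide.
\<close>
lemma canonical_map_ker_coset:
  assumes p: "seminorm_on s X p" and q: "seminorm_on s X q"
    and le: "\<And>x. x \<in> X \<Longrightarrow> q x \<le> c * p x" and x: "x \<in> X"
  shows "canonical_map X q (ker_coset X p x) = ker_coset X q x"
proof -
  have diff: "\<And>x y. x \<in> X \<Longrightarrow> y \<in> X \<Longrightarrow> x - y \<in> X"
    and pos: "\<And>x. x \<in> X \<Longrightarrow> 0 \<le> q x"
    and add: "\<And>x y. x \<in> X \<Longrightarrow> y \<in> X \<Longrightarrow> q (x + y) \<le> q x + q y"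
    using q vector_subspace_closed(3) by (auto simp: seminorm_on_def)
  have "ker_coset X q y = ker_coset X q x" if "y \<in> ker_coset X p x" for y
  proof -
    have y: "y \<in> X" "q (y - x) = 0"
      using that le[of "y - x"] pos[of "y - x"] diff x by (auto simp: ker_coset_def)
    have "q (z - y) = q (z - x)" if "z \<in> X" for z
      using seminorm_on_simps(3)[OF q diff[OF that y(1)] diff[OF that x]]
        seminorm_on_simps(2)[OF q x y(1)] y(2) by simp
    then show ?thesis by (auto simp: ker_coset_def)
  qed
  moreover have "x \<in> ker_coset X p x"
    using x seminorm_on_simps(1)[OF p] by (simp add: ker_coset_def)
  ultimately show ?thesis unfolding canonical_map_def by blast
qed

text \<open>
  A net for the unit ball of \<open>p\<close> in the seminorm \<open>q\<close> on \<open>X\<close> itself suffices, so that no classes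
  occur in the analytic part.
\<close>
lemma canonical_map_precompactI:
  assumes p: "seminorm_on s X p" and q: "seminorm_on s X q"
    and le: "\<And>x. x \<in> X \<Longrightarrow> q x \<le> c * p x"
    and net: "\<And>e. 0 < e \<Longrightarrow> \<exists>K. finite K \<and> K \<subseteq> {x\<in>X. p x \<le> 1} \<and>
        (\<forall>x\<in>X. p x \<le> 1 \<longrightarrow> (\<exists>y\<in>K. q (y - x) < e))"
  shows "canonical_map_precompact X p q"
proof -
  interpret Metric_space "local_space X q" "local_dist X q"
    by (rule Metric_space_local_space[OF q])
  have ball: "canonical_map X q ` {A \<in> local_space X p. local_norm p A \<le> 1} =
      ker_coset X q ` {x\<in>X. p x \<le> 1}"
  proof -
    have "{A \<in> local_space X p. local_norm p A \<le> 1} = ker_coset X p ` {x\<in>X. p x \<le> 1}"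
      using local_norm_ker_coset[OF p] by (auto simp: local_space_def)
    then show ?thesis
      using canonical_map_ker_coset[OF p q le] by (auto simp: image_image)
  qed
  show ?thesis
    unfolding canonical_map_precompact_def ball mtotally_bounded_def
  proof (intro allI impI)
    fix e :: real assume "0 < e"
    from net[OF this] obtain K where K: "finite K" "K \<subseteq> {x\<in>X. p x \<le> 1}"
      "\<And>x. x \<in> X \<Longrightarrow> p x \<le> 1 \<Longrightarrow> \<exists>y\<in>K. q (y - x) < e" by blast
    have "ker_coset X q x \<in> (\<Union>A\<in>ker_coset X q ` K. mball A e)" if x: "x \<in> X" "p x \<le> 1" for x
    proof -
      obtain y where y: "y \<in> K" "q (y - x) < e" using K(3) x by blast
      then have "y \<in> X" "local_dist X q (ker_coset X q y) (ker_coset X q x) < e"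
        using K(2) x local_dist_ker_coset[OF q] by auto
      then have "ker_coset X q x \<in> mball (ker_coset X q y) e"
        using x unfolding in_mball by (auto simp: local_space_def)
      then show ?thesis using y(1) by blast
    qed
    then show "\<exists>K. finite K \<and> K \<subseteq> ker_coset X q ` {x\<in>X. p x \<le> 1} \<and>
        ker_coset X q ` {x\<in>X. p x \<le> 1} \<subseteq> (\<Union>x\<in>K. mball x e)"
      using K(1,2) by (intro exI[of _ "ker_coset X q ` K"]) auto
  qed
qed

section \<open>A line integral with an exponential\<close>

lemma
  fixes c :: real
  assumes c: "0 < c"
  shows integrable_inverse_sum_squares: "integrable lborel (\<lambda>y. 1 / (c\<^sup>2 + y\<^sup>2))" (is ?int)
    and integral_inverse_sum_squares: "(\<integral>y. 1 / (c\<^sup>2 + y\<^sup>2) \<partial>lborel) = pi / c" (is ?eq)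
proof -
  let ?F = "\<lambda>y. arctan (y / c) / c"
  have pos: "c\<^sup>2 + y\<^sup>2 > 0" for y using c by (simp add: add_pos_nonneg)
  have deriv: "DERIV ?F y :> 1 / (c\<^sup>2 + y\<^sup>2)" for y
  proof -
    have "1 + (y / c)\<^sup>2 = (c\<^sup>2 + y\<^sup>2) / c\<^sup>2" using c by (simp add: power_divide add_divide_distrib)
    then have "inverse (1 + (y / c)\<^sup>2) * (1 / c) / c = 1 / (c\<^sup>2 + y\<^sup>2)"
      using c by (simp add: power2_eq_square)
    moreover have "DERIV ?F y :> inverse (1 + (y / c)\<^sup>2) * (1 / c) / c"
      by (intro DERIV_cdivide DERIV_chain2[OF DERIV_arctan] DERIV_ident)
    ultimately show ?thesis by simp
  qed
  have top: "(?F \<longlongrightarrow> (pi / 2) / c) at_top"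
    by (rule tendsto_divide[OF filterlim_compose[OF tendsto_arctan_at_top] tendsto_const])
      (use c in \<open>auto intro!: filterlim_tendsto_pos_mult_at_top[of "\<lambda>_. 1 / c" "1 / c" _ "\<lambda>y. y", simplified] filterlim_ident\<close>)
  have bot: "(?F \<longlongrightarrow> (- pi / 2) / c) at_bot"
    using tendsto_minus[OF top] by (subst filterlim_at_bot_mirror) (simp add: arctan_minus)
  have eq: "((?F \<circ> real_of_ereal) \<longlongrightarrow> (- pi / 2) / c) (at_right (-\<infinity>))"
    "((?F \<circ> real_of_ereal) \<longlongrightarrow> (pi / 2) / c) (at_left \<infinity>)"
    using top bot by (simp_all add: ereal_tendsto_simps)
  have cont: "isCont (\<lambda>y. 1 / (c\<^sup>2 + y\<^sup>2)) y" for y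
    using pos[of y] by (intro continuous_intros) auto
  note * = interval_integral_FTC_nonneg[where a = "-\<infinity>" and b = "\<infinity>", OF _ deriv cont _ eq]
  show ?int using *(1) pos by (simp add: set_integrable_def less_imp_le)
  show ?eq using *(2) pos
    by (simp add: interval_lebesgue_integral_def set_lebesgue_integral_def less_imp_le)
qed

text \<open>
  The function \<open>1 / ((2c - z) z\<^sup>2)\<close> on the line \<open>Re z = c\<close>. There \<open>2c - z\<close> is the conjugate of \<open>z\<close>, so
  the modulus is exactly \<open>|z|\<^bsup>-3\<^esup>\<close>.
\<close>
definition line_kernel :: "real \<Rightarrow> real \<Rightarrow> complex" where
  "line_kernel c y = 1 / (Complex c (- y) * (Complex c y)\<^sup>2)"

lemma Complex_neq_0: "0 < c \<Longrightarrow> Complex c y \<noteq> 0"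
  by (simp add: complex_eq_iff)

lemma continuous_on_Complex_line [continuous_intros]:
  "continuous_on S g \<Longrightarrow> continuous_on S (\<lambda>y. Complex c (g y))"
  unfolding Complex_eq by (intro continuous_intros)

lemma continuous_on_line_kernel [continuous_intros]: "0 < c \<Longrightarrow> continuous_on S (line_kernel c)"
  unfolding line_kernel_def by (intro continuous_intros) (simp add: Complex_neq_0)

lemma norm_line_kernel: "norm (line_kernel c y) = 1 / norm (Complex c y) ^ 3"
  by (simp add: line_kernel_def norm_divide norm_mult norm_power complex_norm power3_eq_cube power2_eq_square)

lemma norm_line_kernel_le:
  assumes "0 < c"
  shows "norm (line_kernel c y) \<le> 1 / c * (1 / (c\<^sup>2 + y\<^sup>2))"
proof -
  let ?z = "Complex c y"
  have "c \<le> norm ?z" using complex_Re_le_cmod[of ?z] by simp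
  moreover have "norm ?z ^ 2 = c\<^sup>2 + y\<^sup>2" by (simp add: complex_norm)
  moreover have "norm ?z ^ 3 = norm ?z * norm ?z ^ 2" by (simp add: eval_nat_numeral)
  moreover have "c\<^sup>2 + y\<^sup>2 > 0" using assms by (simp add: add_pos_nonneg)
  ultimately have "c * (c\<^sup>2 + y\<^sup>2) \<le> norm ?z ^ 3" "0 < c * (c\<^sup>2 + y\<^sup>2)"
    using assms by (simp_all add: mult_right_mono)
  then show ?thesis unfolding norm_line_kernel by (simp add: frac_le)
qed

text \<open>
  Estimating \<open>|z|\<^bsup>-3\<^esup>\<close> by \<open>1 / (c |z|\<^sup>2)\<close> reduces both claims to the integral of the Cauchy density.
\<close>
lemma integrable_mult_line_kernel:
  fixes g :: "real \<Rightarrow> complex"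
  assumes "0 < c" "g \<in> borel_measurable borel" "\<And>y. norm (g y) \<le> B"
  shows "integrable lborel (\<lambda>y. g y * line_kernel c y)"
    and "norm (\<integral>y. g y * line_kernel c y \<partial>lborel) \<le> B * pi / c\<^sup>2"
proof -
  have bd: "norm (g y * line_kernel c y) \<le> B / c * (1 / (c\<^sup>2 + y\<^sup>2))" for y
  proof -
    have "0 \<le> B" using assms(3)[of y] norm_ge_zero order_trans by blast
    then show ?thesis
      using mult_mono[OF assms(3)[of y] norm_line_kernel_le[OF assms(1), of y]]
      by (simp add: norm_mult)
  qed
  have meas: "line_kernel c \<in> borel_measurable borel"
    by (intro borel_measurable_continuous_onI continuous_intros assms)
  have int: "integrable lborel (\<lambda>y. B / c * (1 / (c\<^sup>2 + y\<^sup>2)))"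
    using integrable_inverse_sum_squares[OF assms(1)] by (rule integrable_mult_right)
  show *: "integrable lborel (\<lambda>y. g y * line_kernel c y)"
    by (rule Bochner_Integration.integrable_bound[OF int]) (use assms meas in \<open>auto intro!: AE_I2 order_trans[OF bd] divide_right_mono simp del: norm_mult\<close>)
  have "norm (\<integral>y. g y * line_kernel c y \<partial>lborel) \<le> (\<integral>y. norm (g y * line_kernel c y) \<partial>lborel)"
    by simp
  also have "\<dots> \<le> (\<integral>y. B / c * (1 / (c\<^sup>2 + y\<^sup>2)) \<partial>lborel)"
    by (rule integral_mono[OF integrable_norm[OF *] int bd])
  also have "\<dots> = B / c * (pi / c)"
    by (simp only: integral_mult_right_zero integral_inverse_sum_squares[OF assms(1)])
  finally show "norm (\<integral>y. g y * line_kernel c y \<partial>lborel) \<le> B * pi / c\<^sup>2"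
    by (simp add: power2_eq_square)
qed

text \<open>
  The contour closed in the right half-plane. The difference of a primitive of \<open>H\<close> is estimated along
  three sides of a rectangle with distance of order \<open>R\<close> from \<open>0\<close> and from \<open>a\<close>; their length is \<open>4 R\<close>, and
  \<open>H\<close> is of order \<open>R\<^bsup>-3\<^esup>\<close> on them.
\<close>
lemma primitive_line_difference_tendsto_0:
  fixes G H :: "complex \<Rightarrow> complex"
  assumes c: "0 < c" and G: "\<And>z. 0 < Re z \<Longrightarrow> (G has_field_derivative H z) (at z)"
    and H: "\<And>z. c \<le> Re z \<Longrightarrow> z \<noteq> of_real a \<Longrightarrow> norm (H z) \<le> C / (norm (z - of_real a) * (norm z)\<^sup>2)"
    and a: "c \<le> a" and C: "0 \<le> C"
  shows "((\<lambda>R. G (Complex c R) - G (Complex c (- R))) \<longlongrightarrow> 0) at_top"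
proof (rule Lim_null_comparison)
  show "((\<lambda>R. 8 * C * (1 / (R * R))) \<longlongrightarrow> 0) at_top" by real_asymp
  show "\<forall>\<^sub>F R in at_top. norm (G (Complex c R) - G (Complex c (- R))) \<le> 8 * C * (1 / (R * R))"
  proof (rule eventually_at_top_linorderI)
    fix R :: real assume R: "2 * a \<le> R"
    then have R0: "0 < R" using a c by simp
    let ?B = "2 * C / (R * (R * R))"
    have bd: "norm (G x - G y) \<le> ?B * norm (x - y)"
      if seg: "\<And>z. z \<in> closed_segment x y \<Longrightarrow>
          c \<le> Re z \<and> R \<le> norm z \<and> R / 2 \<le> norm (z - of_real a)" for x y
    proof (rule field_differentiable_bound[where S = "closed_segment x y" and f' = H])
      fix z assume z: "z \<in> closed_segment x y"
      show "(G has_field_derivative H z) (at z within closed_segment x y)"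
        using G[of z] seg[OF z] c by (simp add: has_field_derivative_at_within)
      have "norm (H z) \<le> C / (norm (z - of_real a) * (norm z)\<^sup>2)"
        using seg[OF z] R0 by (intro H) auto
      also have "\<dots> \<le> C / (R / 2 * (R * R))"
        using seg[OF z] R0 C unfolding power2_eq_square
        by (intro divide_left_mono mult_mono mult_pos_pos) auto
      finally show "norm (H z) \<le> ?B" by (simp add: mult.commute)
    qed auto
    let ?p = "Complex c (- R)" and ?q = "Complex (c + R) (- R)"
      and ?r = "Complex (c + R) R" and ?t = "Complex c R"
    have horiz: "R \<le> norm z" "R / 2 \<le> norm (z - of_real a)" if "\<bar>Im z\<bar> = R" for z
      using abs_Im_le_cmod[of z] abs_Im_le_cmod[of "z - of_real a"] that R0 by auto
    have vert: "R \<le> norm z" "R / 2 \<le> norm (z - of_real a)" if "Re z = c + R" for z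
      using complex_Re_le_cmod[of z] complex_Re_le_cmod[of "z - of_real a"] that R R0 c by auto
    have 1: "norm (G ?q - G ?p) \<le> ?B * norm (?q - ?p)"
    proof (rule bd)
      fix z assume "z \<in> closed_segment ?q ?p"
      then have "c \<le> Re z" "\<bar>Im z\<bar> = R"
        using R0 by (auto simp: closed_segment_same_Im closed_segment_eq_real_ivl)
      then show "c \<le> Re z \<and> R \<le> norm z \<and> R / 2 \<le> norm (z - of_real a)" using horiz by auto
    qed
    have 2: "norm (G ?r - G ?q) \<le> ?B * norm (?r - ?q)"
    proof (rule bd)
      fix z assume "z \<in> closed_segment ?r ?q"
      then have "Re z = c + R" by (auto simp: closed_segment_same_Re)
      then show "c \<le> Re z \<and> R \<le> norm z \<and> R / 2 \<le> norm (z - of_real a)" using vert R0 by auto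
    qed
    have 3: "norm (G ?t - G ?r) \<le> ?B * norm (?t - ?r)"
    proof (rule bd)
      fix z assume "z \<in> closed_segment ?t ?r"
      then have "c \<le> Re z" "\<bar>Im z\<bar> = R"
        using R0 by (auto simp: closed_segment_same_Im closed_segment_eq_real_ivl)
      then show "c \<le> Re z \<and> R \<le> norm z \<and> R / 2 \<le> norm (z - of_real a)" using horiz by auto
    qed
    have n: "norm (?q - ?p) = R" "norm (?r - ?q) = 2 * R" "norm (?t - ?r) = R"
      using R0 by (simp_all add: cmod_def real_sqrt_mult)
    have "norm (G ?t - G ?p) \<le> norm (G ?t - G ?r) + norm (G ?r - G ?q) + norm (G ?q - G ?p)"
      using norm_triangle_ineq[of "G ?t - G ?r" "G ?r - G ?p"]
        norm_triangle_ineq[of "G ?r - G ?q" "G ?q - G ?p"] by simp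
    also have "\<dots> \<le> ?B * R + ?B * (2 * R) + ?B * R"
      using 1 2 3 unfolding n by linarith
    also have "\<dots> = 8 * C * (1 / (R * R))" using R0 by (simp add: field_simps)
    finally show "norm (G ?t - G ?p) \<le> 8 * C * (1 / (R * R))" .
  qed
qed

text \<open>
  The residue of \<open>e\<^bsup>-wz\<^esup> / ((2c - z) z\<^sup>2)\<close> at \<open>2c\<close>. Subtracting the value of \<open>e\<^bsup>-wz\<^esup>\<close> at the pole makes the
  integrand holomorphic in the right half-plane, and the sign of \<open>w\<close> keeps it of order \<open>|z|\<^bsup>-3\<^esup>\<close> there, so
  that its integral vanishes. What was subtracted is a multiple of the kernel itself, which has the
  elementary primitive \<open>\<i> / (2cz) + arctan (y/c) / (2c\<^sup>2)\<close> along \<open>z = c + \<i>y\<close>.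
\<close>
lemma exp_line_kernel_integral:
  fixes c w :: real
  assumes c: "0 < c" and w: "0 \<le> w"
  shows "(\<integral>y. exp (- (of_real w * Complex c y)) * line_kernel c y \<partial>lborel) =
    of_real (pi / (2 * c\<^sup>2) * exp (- (2 * c * w)))"
proof -
  let ?e = "\<lambda>z::complex. exp (- (of_real w * z))"
  let ?a = "complex_of_real (2 * c)"
  let ?S = "{z. 0 < Re z}"
  \<comment> \<open>\<open>H\<close> is \<open>(?e z - ?e ?a) / ((2c - z) z\<^sup>2)\<close> with the singularity at \<open>2c\<close> removed.\<close>
  define Q where "Q z = (if z = ?a then deriv ?e ?a else (?e z - ?e ?a) / (z - ?a))" for z
  define H where "H z = - Q z / z\<^sup>2" for z
  have S: "open ?S" "convex ?S" by (simp_all add: open_halfspace_Re_gt convex_halfspace_Re_gt)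
  have "Q holomorphic_on ?S"
    unfolding Q_def by (intro pole_lemma_open S holomorphic_intros)
  then have hol: "H holomorphic_on ?S"
    unfolding H_def by (intro holomorphic_intros) auto
  obtain G where G': "\<And>z. z \<in> ?S \<Longrightarrow> (G has_field_derivative H z) (at z within ?S)"
    by (rule holomorphic_convex_primitive'[OF S(2,1) hol]) (rule that)
  have G: "(G has_field_derivative H z) (at z)" if "0 < Re z" for z
  proof -
    have "z \<in> ?S" using that by simp
    from G'[OF this] show ?thesis unfolding at_within_open[OF \<open>z \<in> ?S\<close> S(1)] .
  qed
  have Gnull: "((\<lambda>R. G (Complex c R) - G (Complex c (- R))) \<longlongrightarrow> 0) at_top"
  proof (rule primitive_line_difference_tendsto_0[OF c G])
    fix z :: complex assume z: "c \<le> Re z" "z \<noteq> of_real (2 * c)"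
    have "norm (?e z) \<le> 1" "norm (?e ?a) \<le> 1" using z c w by auto
    then have "norm (?e z - ?e ?a) \<le> 2"
      using norm_triangle_ineq4[of "?e z" "?e ?a"] by linarith
    then have "norm (?e z - ?e ?a) / (norm (z - ?a) * (norm z)\<^sup>2) \<le> 2 / (norm (z - ?a) * (norm z)\<^sup>2)"
      by (intro divide_right_mono) auto
    then show "norm (H z) \<le> 2 / (norm (z - of_real (2 * c)) * (norm z)\<^sup>2)"
      using z by (simp add: H_def Q_def norm_divide norm_mult norm_power)
  qed (use c in auto)
  let ?f = "\<lambda>y. ?e (Complex c y) * line_kernel c y"
  define F where "F y = - \<i> * G (Complex c y) +
      ?e ?a * (\<i> / (2 * of_real c * Complex c y) + of_real (arctan (y / c) / (2 * c\<^sup>2)))" for y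
  have deriv: "(F has_vector_derivative ?f y) (at y)" for y
  proof -
    let ?z = "Complex c y"
    have z0: "?z \<noteq> 0" "Complex c (- y) \<noteq> 0" using c by (simp_all add: complex_eq_iff)
    have line: "((\<lambda>y. Complex c y) has_vector_derivative \<i>) (at y)"
      unfolding Complex_eq by (auto intro!: derivative_eq_intros)
    have 1: "((\<lambda>y. G (Complex c y)) has_vector_derivative \<i> * H ?z) (at y)"
      using field_vector_diff_chain_at[OF line G] c by (simp add: o_def)
    have "((\<lambda>z. \<i> / (2 * of_real c * z)) has_field_derivative - \<i> / (2 * of_real c * ?z\<^sup>2)) (at ?z)"
      using z0 c by (auto intro!: derivative_eq_intros simp: field_simps power2_eq_square)
    from field_vector_diff_chain_at[OF line this]
    have 2: "((\<lambda>y. \<i> / (2 * of_real c * Complex c y)) has_vector_derivative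
        1 / (2 * of_real c * ?z\<^sup>2)) (at y)"
      by (simp add: o_def)
    have "DERIV (\<lambda>y. arctan (y / c) / (2 * c\<^sup>2)) y :> 1 / (2 * c * (c\<^sup>2 + y\<^sup>2))"
      using c by (auto intro!: derivative_eq_intros simp: divide_simps add_nonneg_eq_0_iff power2_eq_square)
    then have 3: "((\<lambda>y. of_real (arctan (y / c) / (2 * c\<^sup>2)) :: complex) has_vector_derivative
        of_real (1 / (2 * c * (c\<^sup>2 + y\<^sup>2)))) (at y)"
      by (intro has_vector_derivative_of_real)
    have cc: "of_real (c\<^sup>2 + y\<^sup>2) = ?z * Complex c (- y)"
      by (simp add: complex_eq_iff power2_eq_square)
    have 4: "- \<i> * (\<i> * H ?z) +
        ?e ?a * (1 / (2 * of_real c * ?z\<^sup>2) + of_real (1 / (2 * c * (c\<^sup>2 + y\<^sup>2)))) = ?f y"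
    proof -
      have za: "?a - ?z = Complex c (- y)" by (simp add: complex_eq_iff)
      have "?z \<noteq> ?a" using z0(2) za by auto
      then have Hz: "H ?z = (?e ?z - ?e ?a) / (Complex c (- y) * ?z\<^sup>2)"
        using z0 unfolding H_def Q_def za[symmetric] by (simp add: field_simps)
      have c2: "2 * of_real c = ?z + Complex c (- y)" by (simp add: complex_eq_iff)
      have "1 / (2 * of_real c * ?z\<^sup>2) + of_real (1 / (2 * c * (c\<^sup>2 + y\<^sup>2))) =
          1 / (2 * of_real c * ?z\<^sup>2) + 1 / (2 * of_real c * (?z * Complex c (- y)))"
        unfolding cc[symmetric] by simp
      also have "\<dots> = (Complex c (- y) + ?z) / (2 * of_real c * (Complex c (- y) * ?z\<^sup>2))"
        using z0 c by (simp add: field_simps power2_eq_square)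
      also have "\<dots> = 1 / (Complex c (- y) * ?z\<^sup>2)"
        using c by (simp add: c2[symmetric] add.commute)
      finally show ?thesis
        unfolding Hz line_kernel_def by (simp add: diff_divide_distrib)
    qed
    show ?thesis
      unfolding F_def 4[symmetric]
      by (intro has_vector_derivative_add has_vector_derivative_mult_right 1 2 3)
  qed
  have cont: "continuous_on UNIV ?f" by (intro continuous_intros c)
  have int: "integrable lborel ?f"
  proof (rule integrable_mult_line_kernel[OF c])
    show "(\<lambda>y. ?e (Complex c y)) \<in> borel_measurable borel"
      by (intro borel_measurable_continuous_onI continuous_intros)
    show "norm (?e (Complex c y)) \<le> 1" for y using c w by simp
  qed
  have "((\<lambda>R. \<integral>y. indicator {-R..R} y *\<^sub>R ?f y \<partial>lborel) \<longlongrightarrow> (\<integral>y. ?f y \<partial>lborel)) at_top"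
  proof (rule integral_dominated_convergence_at_top[where w = "\<lambda>y. norm (?f y)"])
    show "?f \<in> borel_measurable lborel" "integrable lborel (\<lambda>y. norm (?f y))"
      using int by auto
    show "(\<lambda>y. indicator {-R..R} y *\<^sub>R ?f y) \<in> borel_measurable lborel" for R :: real
      using int by auto
    show "AE y in lborel. ((\<lambda>R. indicator {-R..R} y *\<^sub>R ?f y) \<longlongrightarrow> ?f y) at_top"
    proof (rule AE_I2)
      fix y :: real
      have "\<forall>\<^sub>F R in at_top. indicator {-R..R} y *\<^sub>R ?f y = ?f y"
        by (rule eventually_at_top_linorderI[of "\<bar>y\<bar>"]) (auto simp: indicator_def)
      then show "((\<lambda>R. indicator {-R..R} y *\<^sub>R ?f y) \<longlongrightarrow> ?f y) at_top"
        by (rule tendsto_eventually)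
    qed
  qed (auto intro!: always_eventually simp: indicator_def)
  moreover have "\<forall>\<^sub>F R in at_top. (\<integral>y. indicator {-R..R} y *\<^sub>R ?f y \<partial>lborel) = F R - F (- R)"
    by (rule eventually_at_top_linorderI[of 0], rule integral_FTC_atLeastAtMost)
      (auto intro: has_vector_derivative_at_within deriv continuous_on_subset[OF cont])
  ultimately have lim1: "((\<lambda>R. F R - F (- R)) \<longlongrightarrow> (\<integral>y. ?f y \<partial>lborel)) at_top"
    using tendsto_cong by force
  have inv: "((\<lambda>R. \<i> / (2 * of_real c * Complex c R)) \<longlongrightarrow> 0) at_top"
    "((\<lambda>R. \<i> / (2 * of_real c * Complex c (- R))) \<longlongrightarrow> 0) at_top"
  proof -
    have lim: "((\<lambda>R. 1 / (2 * c) * (1 / R)) \<longlongrightarrow> 0) at_top" by real_asymp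
    have bound: "norm (\<i> / (2 * of_real c * Complex c r)) \<le> 1 / (2 * c) * (1 / R)"
      if "1 \<le> R" "\<bar>r\<bar> = R" for r R
      using that c abs_Im_le_cmod[of "Complex c r"]
      by (simp add: norm_divide norm_mult frac_le)
    show "((\<lambda>R. \<i> / (2 * of_real c * Complex c R)) \<longlongrightarrow> 0) at_top"
      "((\<lambda>R. \<i> / (2 * of_real c * Complex c (- R))) \<longlongrightarrow> 0) at_top"
      by (rule Lim_null_comparison[OF eventually_at_top_linorderI[of 1] lim]; rule bound; simp)+
  qed
  have at: "((\<lambda>R. of_real (arctan (R / c) / c\<^sup>2) :: complex) \<longlongrightarrow> of_real (pi / 2 / c\<^sup>2)) at_top"
    by (intro tendsto_of_real tendsto_divide[OF filterlim_compose[OF tendsto_arctan_at_top] tendsto_const])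
      (use c in \<open>auto intro!: filterlim_tendsto_pos_mult_at_top[of "\<lambda>_. 1 / c" "1 / c" _ "\<lambda>y. y", simplified] filterlim_ident\<close>)
  have "F R - F (- R) = - \<i> * (G (Complex c R) - G (Complex c (- R))) +
      ?e ?a * (\<i> / (2 * of_real c * Complex c R) - \<i> / (2 * of_real c * Complex c (- R)) +
        of_real (arctan (R / c) / c\<^sup>2))" for R
  proof -
    have "of_real (arctan (R / c) / c\<^sup>2) =
        (of_real (arctan (R / c) / (2 * c\<^sup>2)) - of_real (arctan (- R / c) / (2 * c\<^sup>2)) :: complex)"
      using c by (simp add: arctan_minus field_simps)
    moreover have "(- \<i> * g1 + E * (i1 + x1)) - (- \<i> * g2 + E * (i2 + x2)) =
        - \<i> * (g1 - g2) + E * (i1 - i2 + (x1 - x2))" for E g1 g2 i1 i2 x1 x2 :: complex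
      by (simp add: algebra_simps)
    ultimately show ?thesis unfolding F_def by (simp only:)
  qed
  then have lim2: "((\<lambda>R. F R - F (- R)) \<longlongrightarrow> - \<i> * 0 + ?e ?a * (0 - 0 + of_real (pi / 2 / c\<^sup>2))) at_top"
    by (simp only:) (intro tendsto_intros Gnull inv at)
  have "(\<integral>y. ?f y \<partial>lborel) = - \<i> * 0 + ?e ?a * (0 - 0 + of_real (pi / 2 / c\<^sup>2))"
    by (rule tendsto_unique[OF _ lim1 lim2]) simp
  also have "?e ?a = of_real (exp (- (2 * c * w)))"
    by (simp add: exp_of_real[symmetric] mult.commute)
  finally show ?thesis by (simp add: mult.commute)
qed

section \<open>Linear structure of the spaces of Dirichlet series\<close>

lemma ds_term_shift: "ds_term lam (ds_shift lam \<sigma> a) s = ds_term lam a (s + of_real \<sigma>)"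
  by (simp add: ds_term_def ds_shift_def fun_eq_iff exp_add[symmetric] algebra_simps)

lemma ds_fun_shift: "ds_fun lam (ds_shift lam \<sigma> a) s = ds_fun lam a (s + of_real \<sigma>)"
  by (simp add: ds_fun_def ds_term_shift)

lemma ds_shift_shift: "ds_shift lam \<sigma> (ds_shift lam \<tau> a) = ds_shift lam (\<sigma> + \<tau>) a"
  by (simp add: ds_shift_def fun_eq_iff exp_add[symmetric] algebra_simps)

lemma ds_shift_0 [simp]: "ds_shift lam 0 a = a"
  by (simp add: ds_shift_def)

lemma ds_shift_linear:
  "ds_shift lam \<sigma> (a + b) = ds_shift lam \<sigma> a + ds_shift lam \<sigma> b"
  "ds_shift lam \<sigma> (a - b) = ds_shift lam \<sigma> a - ds_shift lam \<sigma> b"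
  "ds_shift lam \<sigma> (ds_scale c a) = ds_scale c (ds_shift lam \<sigma> a)"
  "ds_shift lam \<sigma> 0 = 0"
  by (simp_all add: ds_shift_def ds_scale_def pointwise_scale_def fun_eq_iff algebra_simps)

lemma ds_term_linear:
  "ds_term lam (a + b) s = (\<lambda>n. ds_term lam a s n + ds_term lam b s n)"
  "ds_term lam (ds_scale c a) s = (\<lambda>n. c * ds_term lam a s n)"
  "ds_term lam 0 s = (\<lambda>n. 0)"
  by (simp_all add: ds_term_def ds_scale_def pointwise_scale_def fun_eq_iff algebra_simps)

lemma vector_space_ds_scale: "vector_space ds_scale"
  unfolding ds_scale_def
  by (rule vector_space_pointwise_scale) (unfold_locales, simp_all add: algebra_simps)

lemma ds_shift_in_D_inf_iff:
  "ds_shift lam \<sigma> a \<in> D_inf lam \<longleftrightarrow>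
     (\<forall>s\<in>right_half_plane \<sigma>. summable (ds_term lam a s)) \<and> bounded (ds_fun lam a ` right_half_plane \<sigma>)"
proof -
  have "right_half_plane \<sigma> = (\<lambda>s. s + of_real \<sigma>) ` right_half_plane 0" (is "_ = ?A")
  proof
    show "right_half_plane \<sigma> \<subseteq> ?A"
    proof
      fix s assume "s \<in> right_half_plane \<sigma>"
      then show "s \<in> ?A"
        by (intro image_eqI[of _ _ "s - of_real \<sigma>"]) (auto simp: right_half_plane_def)
    qed
  qed (auto simp: right_half_plane_def)
  then show ?thesis
    by (simp add: D_inf_def ds_converges_def ds_term_shift ds_fun_shift image_image)
qed

lemma D_inf_summable: "a \<in> D_inf lam \<Longrightarrow> 0 < Re s \<Longrightarrow> summable (ds_term lam a s)"
  by (auto simp: D_inf_def ds_converges_def right_half_plane_def)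

lemma norm_ds_fun_le: "a \<in> D_inf lam \<Longrightarrow> 0 < Re s \<Longrightarrow> norm (ds_fun lam a s) \<le> norm_inf lam a"
  unfolding norm_inf_def
  by (rule cSUP_upper) (auto simp: D_inf_def right_half_plane_def bounded_iff bdd_above_def)

lemma norm_inf_le:
  "(\<And>s. 0 < Re s \<Longrightarrow> norm (ds_fun lam a s) \<le> B) \<Longrightarrow> norm_inf lam a \<le> B"
  unfolding norm_inf_def
  by (rule cSUP_least) (auto simp: right_half_plane_def intro: exI[of _ 1])

lemma D_inf_I:
  "(\<And>s. 0 < Re s \<Longrightarrow> summable (ds_term lam a s)) \<Longrightarrow>
   (\<And>s. 0 < Re s \<Longrightarrow> norm (ds_fun lam a s) \<le> B) \<Longrightarrow> a \<in> D_inf lam"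
  by (auto simp: D_inf_def ds_converges_def right_half_plane_def bounded_iff)

lemma norm_inf_nonneg: "a \<in> D_inf lam \<Longrightarrow> 0 \<le> norm_inf lam a"
  by (rule order_trans[OF norm_ge_zero norm_ds_fun_le[where s = 1]]) auto

lemma D_inf_zero: "0 \<in> D_inf lam"
  by (rule D_inf_I[where B = 0]) (simp_all add: ds_fun_def ds_term_linear)

lemma
  assumes a: "a \<in> D_inf lam" and b: "b \<in> D_inf lam"
  shows D_inf_add: "a + b \<in> D_inf lam"
    and norm_inf_add_le: "norm_inf lam (a + b) \<le> norm_inf lam a + norm_inf lam b"
proof -
  have "norm (ds_fun lam (a + b) s) \<le> norm_inf lam a + norm_inf lam b" if s: "0 < Re s" for s
  proof -
    have "ds_fun lam (a + b) s = ds_fun lam a s + ds_fun lam b s"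
      unfolding ds_fun_def ds_term_linear
      by (rule suminf_add[symmetric]) (use D_inf_summable a b s in auto)
    then show ?thesis
      using norm_triangle_mono[OF norm_ds_fun_le[OF a s] norm_ds_fun_le[OF b s]] by simp
  qed
  then show "a + b \<in> D_inf lam" "norm_inf lam (a + b) \<le> norm_inf lam a + norm_inf lam b"
    using D_inf_I[of lam "a + b" "norm_inf lam a + norm_inf lam b"] norm_inf_le
    by (auto simp: ds_term_linear summable_add D_inf_summable[OF a] D_inf_summable[OF b])
qed

lemma
  assumes a: "a \<in> D_inf lam"
  shows D_inf_scale: "ds_scale c a \<in> D_inf lam"
    and norm_inf_scale_le: "norm_inf lam (ds_scale c a) \<le> cmod c * norm_inf lam a"
proof -
  have "norm (ds_fun lam (ds_scale c a) s) \<le> cmod c * norm_inf lam a" if s: "0 < Re s" for s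
  proof -
    have "ds_fun lam (ds_scale c a) s = c * ds_fun lam a s"
      unfolding ds_fun_def ds_term_linear
      by (rule suminf_mult) (rule D_inf_summable[OF a s])
    then show ?thesis
      using norm_ds_fun_le[OF a s] by (simp add: norm_mult mult_left_mono)
  qed
  then show "ds_scale c a \<in> D_inf lam" "norm_inf lam (ds_scale c a) \<le> cmod c * norm_inf lam a"
    using D_inf_I[of lam "ds_scale c a" "cmod c * norm_inf lam a"] norm_inf_le
    by (auto simp: ds_term_linear summable_mult D_inf_summable[OF a])
qed

lemma vector_subspace_D_inf: "vector_subspace ds_scale (D_inf lam)"
  by (rule vector_subspaceI) (auto intro: vector_space_ds_scale D_inf_zero D_inf_add D_inf_scale)

lemma norm_inf_scale:
  assumes a: "a \<in> D_inf lam"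
  shows "norm_inf lam (ds_scale c a) = cmod c * norm_inf lam a"
proof (cases "c = 0")
  case True
  have "norm_inf lam (ds_scale 0 a) \<le> 0" "0 \<le> norm_inf lam (ds_scale 0 a)"
    using norm_inf_scale_le[OF a, of 0] norm_inf_nonneg[OF D_inf_scale[OF a, of 0]] by auto
  then show ?thesis using True by simp
next
  case False
  have "ds_scale (inverse c) (ds_scale c a) = a"
    using False by (simp add: ds_scale_def pointwise_scale_def fun_eq_iff)
  then have "norm_inf lam a \<le> cmod (inverse c) * norm_inf lam (ds_scale c a)"
    using norm_inf_scale_le[OF D_inf_scale[OF a], of "inverse c" c] by simp
  then have "cmod c * norm_inf lam a \<le> norm_inf lam (ds_scale c a)"
    using False by (simp add: norm_inverse norm_divide field_simps)
  then show ?thesis using norm_inf_scale_le[OF a, of c] by simp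
qed

lemma seminorm_on_norm_inf: "seminorm_on ds_scale (D_inf lam) (norm_inf lam)"
  unfolding seminorm_on_def
  using vector_subspace_D_inf norm_inf_nonneg norm_inf_scale norm_inf_add_le by blast

lemma
  assumes a: "a \<in> D_inf lam" and \<sigma>: "0 \<le> \<sigma>"
  shows D_inf_shift: "ds_shift lam \<sigma> a \<in> D_inf lam"
    and norm_inf_shift_le: "norm_inf lam (ds_shift lam \<sigma> a) \<le> norm_inf lam a"
proof -
  have pos: "0 < Re (s + of_real \<sigma>)" if "0 < Re s" for s using that \<sigma> by simp
  have "norm (ds_fun lam (ds_shift lam \<sigma> a) s) \<le> norm_inf lam a" if "0 < Re s" for s
    unfolding ds_fun_shift by (rule norm_ds_fun_le[OF a pos[OF that]])
  moreover have "summable (ds_term lam (ds_shift lam \<sigma> a) s)" if "0 < Re s" for s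
    unfolding ds_term_shift by (rule D_inf_summable[OF a pos[OF that]])
  ultimately show "ds_shift lam \<sigma> a \<in> D_inf lam"
    "norm_inf lam (ds_shift lam \<sigma> a) \<le> norm_inf lam a"
    by (blast intro: D_inf_I norm_inf_le)+
qed

section \<open>Approximating translates by Dirichlet polynomials\<close>

text \<open>
  The difference is the integral of \<open>w e\<^bsup>-tw\<^esup>\<close> over \<open>[a, b]\<close>, whose modulus is \<open>|w| e\<^bsup>-t Re w\<^esup>\<close>.
\<close>
lemma norm_exp_diff_le:
  assumes "a \<le> b" and w: "0 < Re w"
  shows "norm (exp (- (of_real a * w)) - exp (- (of_real b * w))) \<le>
    norm w / Re w * (exp (- (a * Re w)) - exp (- (b * Re w)))"
proof (cases "a = b")
  case False
  let ?f = "\<lambda>t. exp (- (of_real t * w))"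
  let ?\<phi> = "\<lambda>t. - (norm w / Re w) * exp (- (t * Re w))"
  have "norm (?f b - ?f a) \<le> ?\<phi> b - ?\<phi> a"
  proof (rule differentiable_bound_general)
    show "a < b" using assms False by simp
    show "continuous_on {a..b} ?f" "continuous_on {a..b} ?\<phi>" by (intro continuous_intros)+
    fix t
    have "((\<lambda>z. exp (- (z * w))) has_field_derivative - w * exp (- (of_real t * w))) (at (of_real t))"
      by (auto intro!: derivative_eq_intros)
    then show "(?f has_vector_derivative - w * ?f t) (at t)"
      by (rule has_vector_derivative_real_field)
    show "(?\<phi> has_vector_derivative norm w * exp (- (t * Re w))) (at t)"
      unfolding has_real_derivative_iff_has_vector_derivative[symmetric]
      using w by (auto intro!: derivative_eq_intros)
    show "norm (- w * ?f t) \<le> norm w * exp (- (t * Re w))"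
      by (simp add: norm_mult)
  qed
  then show ?thesis by (simp add: norm_minus_commute right_diff_distrib)
qed simp

lemma summation_by_parts_lessThan:
  fixes \<alpha> e :: "nat \<Rightarrow> 'a::comm_ring"
  shows "(\<Sum>n<N. \<alpha> n * e n) =
    (\<Sum>n<N. \<alpha> n) * e N + (\<Sum>n<N. (\<Sum>k<Suc n. \<alpha> k) * (e n - e (Suc n)))"
  by (induction N) (simp_all add: algebra_simps)

text \<open>
  Abel summation: in the summed form the increments of the exponentials are dominated by a
  telescoping sum. At \<open>w = z\<close> on a fixed line \<open>Re z = c\<close> the bound is linear in \<open>|z|\<close>, and this decides how
  fast the kernel has to decay.
\<close>
lemma partial_sums_exp_bounded:
  fixes \<alpha> :: "nat \<Rightarrow> complex"
  assumes lam: "mono lam" "\<And>n. 0 \<le> lam n" and \<alpha>: "summable \<alpha>"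
  obtains B where "0 \<le> B"
    "\<And>N w. 0 < Re w \<Longrightarrow> norm (\<Sum>n<N. \<alpha> n * exp (- (of_real (lam n) * w))) \<le> B * (1 + norm w / Re w)"
proof -
  have "convergent (\<lambda>N. \<Sum>n<N. \<alpha> n)" using \<alpha> by (simp add: summable_iff_convergent)
  then obtain B where B: "0 < B" "\<And>N. norm (\<Sum>n<N. \<alpha> n) \<le> B"
    using convergent_imp_Bseq BseqE by blast
  show ?thesis
  proof (rule that)
    fix N :: nat and w :: complex assume w: "0 < Re w"
    let ?e = "\<lambda>n. exp (- (of_real (lam n) * w))" and ?x = "\<lambda>n. exp (- (lam n * Re w))"
    have "norm (\<Sum>n<N. (\<Sum>k<Suc n. \<alpha> k) * (?e n - ?e (Suc n))) \<le>
        (\<Sum>n<N. B * (norm w / Re w * (?x n - ?x (Suc n))))"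
    proof (rule sum_norm_le)
      fix n
      have "norm (?e n - ?e (Suc n)) \<le> norm w / Re w * (?x n - ?x (Suc n))"
        by (rule norm_exp_diff_le[OF _ w]) (simp add: monoD[OF lam(1)])
      then show "norm ((\<Sum>k<Suc n. \<alpha> k) * (?e n - ?e (Suc n))) \<le> B * (norm w / Re w * (?x n - ?x (Suc n)))"
        unfolding norm_mult by (intro mult_mono B(2)) (use B in auto)
    qed
    also have "\<dots> = B * (norm w / Re w * (?x 0 - ?x N))"
      by (simp only: sum_distrib_left[symmetric] sum_lessThan_telescope'[of ?x])
    also have "\<dots> \<le> B * (norm w / Re w * 1)"
    proof -
      have "?x 0 \<le> 1" "0 \<le> ?x N" using lam(2)[of 0] w by auto
      then have "?x 0 - ?x N \<le> 1" by linarith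
      then show ?thesis using B w by (intro mult_left_mono) auto
    qed
    finally have 1: "norm (\<Sum>n<N. (\<Sum>k<Suc n. \<alpha> k) * (?e n - ?e (Suc n))) \<le> B * (norm w / Re w)"
      by simp
    have "norm (?e N) \<le> 1" using lam(2)[of N] w by simp
    then have 2: "norm ((\<Sum>n<N. \<alpha> n) * ?e N) \<le> B * 1"
      unfolding norm_mult using B by (intro mult_mono) auto
    show "norm (\<Sum>n<N. \<alpha> n * ?e n) \<le> B * (1 + norm w / Re w)"
      unfolding summation_by_parts_lessThan[of \<alpha> ?e N]
      using norm_triangle_mono[OF 2 1] by (simp add: distrib_left)
  qed (use B in simp)
qed

text \<open>
  The factor by which integration against the kernel multiplies \<open>e\<^bsup>-ls\<^esup>\<close>. The constant in front makes
  it equal to \<open>e\<^bsup>-2cl\<^esup>\<close> for \<open>l \<ge> N\<close>.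
\<close>
definition line_multiplier :: "real \<Rightarrow> real \<Rightarrow> real \<Rightarrow> complex" where
  "line_multiplier c N l = of_real (2 * c\<^sup>2 / pi * exp (- (2 * c * N))) *
     (\<integral>y. exp (of_real (N - l) * Complex c y) * line_kernel c y \<partial>lborel)"

lemma line_multiplier_eq_exp:
  assumes "0 < c" "N \<le> l"
  shows "line_multiplier c N l = exp (- (of_real l * of_real (2 * c)))"
proof -
  have "(\<integral>y. exp (of_real (N - l) * Complex c y) * line_kernel c y \<partial>lborel) =
      (\<integral>y. exp (- (of_real (l - N) * Complex c y)) * line_kernel c y \<partial>lborel)"
    by (simp add: left_diff_distrib)
  also have "\<dots> = of_real (pi / (2 * c\<^sup>2) * exp (- (2 * c * (l - N))))"
    by (rule exp_line_kernel_integral) (use assms in auto)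
  finally have "line_multiplier c N l = of_real (exp (- (2 * c * N)) * exp (- (2 * c * (l - N))))"
    unfolding line_multiplier_def of_real_mult[symmetric] using assms by simp
  also have "exp (- (2 * c * N)) * exp (- (2 * c * (l - N))) = exp (- (l * (2 * c)))"
    by (simp add: exp_add[symmetric] algebra_simps)
  finally show ?thesis by (simp add: exp_of_real[symmetric])
qed

lemma norm_line_multiplier_le:
  assumes "0 < c"
  shows "norm (line_multiplier c N l) \<le> 2 * exp (- ((N + l) * c))"
proof -
  have "norm (\<integral>y. exp (of_real (N - l) * Complex c y) * line_kernel c y \<partial>lborel)
      \<le> exp ((N - l) * c) * pi / c\<^sup>2"
    by (rule integrable_mult_line_kernel(2)[OF assms])
      (auto intro!: borel_measurable_continuous_onI continuous_intros)
  then have "norm (line_multiplier c N l) \<le>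
      2 * c\<^sup>2 / pi * exp (- (2 * c * N)) * (exp ((N - l) * c) * pi / c\<^sup>2)"
    unfolding line_multiplier_def norm_mult norm_of_real by (intro mult_mono) (auto simp: abs_mult)
  also have "\<dots> = 2 * (exp (- (2 * c * N)) * exp ((N - l) * c))"
    using assms by simp
  also have "exp (- (2 * c * N)) * exp ((N - l) * c) = exp (- ((N + l) * c))"
    by (simp add: exp_add[symmetric] algebra_simps)
  finally show ?thesis .
qed

text \<open>
  \<open>L\<close> is the integral of \<open>f(s + z)\<close> against the kernel, where \<open>f\<close> is the sum of the series; the estimate of
  \<open>L\<close> uses only that \<open>f\<close> is bounded, the convergence that the series can be integrated term by term.
\<close>
lemma line_multiplier_series:
  assumes lam: "mono lam" "\<And>n. 0 \<le> lam n" and a: "a \<in> D_inf lam" and s: "0 < Re s" and c: "0 < c"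
  obtains L where "(\<lambda>K. \<Sum>n<K. line_multiplier c N (lam n) * ds_term lam a s n) \<longlonglongrightarrow> L"
    and "norm L \<le> 2 * exp (- (N * c)) * norm_inf lam a"
proof -
  let ?z = "\<lambda>y. Complex c y"
  let ?A = "of_real (2 * c\<^sup>2 / pi * exp (- (2 * c * N))) :: complex"
  let ?g = "\<lambda>y. exp (of_real N * ?z y) * line_kernel c y"
  let ?S = "\<lambda>K y. \<Sum>n<K. ds_term lam a (s + ?z y) n"
  let ?F = "\<lambda>y. ds_fun lam a (s + ?z y)"
  have "summable (ds_term lam a s)" by (rule D_inf_summable[OF a s])
  then obtain B where B: "0 \<le> B" "\<And>K w. 0 < Re w \<Longrightarrow>
      norm (\<Sum>n<K. ds_term lam a s n * exp (- (of_real (lam n) * w))) \<le> B * (1 + norm w / Re w)"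
    using partial_sums_exp_bounded[OF lam] by blast
  have shifted: "ds_term lam a (s + w) n = ds_term lam a s n * exp (- (of_real (lam n) * w))" for w n
    by (simp add: ds_term_def exp_add[symmetric] algebra_simps)
  have bound: "norm (?S K y * ?g y) \<le> 2 * B * exp (N * c) / c * (1 / (c\<^sup>2 + y\<^sup>2))" for K y
  proof -
    have cz: "c \<le> norm (?z y)" using complex_Re_le_cmod[of "?z y"] by simp
    then have pos: "0 < norm (?z y)" using c by linarith
    have "norm (?S K y) \<le> B * (1 + norm (?z y) / c)"
      unfolding shifted using B(2)[of "?z y" K] c by simp
    also have "\<dots> \<le> B * (2 * norm (?z y) / c)"
      using B(1) c cz by (intro mult_left_mono) (auto simp: field_simps)
    finally have "norm (?S K y * ?g y) \<le> (B * (2 * norm (?z y) / c)) * (exp (N * c) * (1 / norm (?z y) ^ 3))"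
      unfolding norm_mult norm_line_kernel by (intro mult_mono) (use B c in auto)
    also have "\<dots> = 2 * B * exp (N * c) / c * (1 / norm (?z y) ^ 2)"
      using pos c by (simp add: field_simps power2_eq_square power3_eq_cube)
    finally show ?thesis by (simp add: complex_norm)
  qed
  have lim: "(\<lambda>K. ?S K y * ?g y) \<longlonglongrightarrow> ?F y * ?g y" for y
  proof -
    have "summable (ds_term lam a (s + ?z y))" by (rule D_inf_summable[OF a]) (use s c in simp)
    then have "(\<lambda>K. ?S K y) \<longlonglongrightarrow> ?F y" unfolding ds_fun_def by (rule summable_LIMSEQ)
    then show ?thesis by (intro tendsto_intros)
  qed
  have measS: "(\<lambda>y. ?S K y * ?g y) \<in> borel_measurable borel" for K
    unfolding ds_term_def by (intro borel_measurable_continuous_onI continuous_intros c)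
  have measF: "?F \<in> borel_measurable borel"
  proof (rule borel_measurable_LIMSEQ_metric)
    show "(\<lambda>y. ?S K y) \<in> borel_measurable borel" for K
      unfolding ds_term_def by (intro borel_measurable_continuous_onI continuous_intros)
    show "(\<lambda>K. ?S K y) \<longlonglongrightarrow> ?F y" for y
      unfolding ds_fun_def by (rule summable_LIMSEQ, rule D_inf_summable[OF a]) (use s c in simp)
  qed
  have conv: "(\<lambda>K. \<integral>y. ?S K y * ?g y \<partial>lborel) \<longlonglongrightarrow> (\<integral>y. ?F y * ?g y \<partial>lborel)"
  proof (rule integral_dominated_convergence[where w = "\<lambda>y. 2 * B * exp (N * c) / c * (1 / (c\<^sup>2 + y\<^sup>2))"])
    show "integrable lborel (\<lambda>y. 2 * B * exp (N * c) / c * (1 / (c\<^sup>2 + y\<^sup>2)))"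
      using integrable_inverse_sum_squares[OF c] by (rule integrable_mult_right)
    show "(\<lambda>y. ?F y * ?g y) \<in> borel_measurable lborel"
      by (rule borel_measurable_LIMSEQ_metric[of "\<lambda>K y. ?S K y * ?g y"])
        (use measS lim in auto)
  qed (use measS bound lim in auto)
  have "?A * (\<integral>y. ?S K y * ?g y \<partial>lborel) = (\<Sum>n<K. line_multiplier c N (lam n) * ds_term lam a s n)" for K
  proof -
    let ?e = "\<lambda>n y. exp (of_real (N - lam n) * ?z y) * line_kernel c y"
    have int: "integrable lborel (?e n)" for n
      by (rule integrable_mult_line_kernel(1)[OF c, where B = "exp ((N - lam n) * c)"])
        (auto intro!: borel_measurable_continuous_onI continuous_intros)
    have "?S K y * ?g y = (\<Sum>n<K. ds_term lam a s n * ?e n y)" for y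
      unfolding shifted sum_distrib_right
      by (rule sum.cong) (simp_all add: left_diff_distrib exp_diff exp_minus field_simps)
    then have "(\<integral>y. ?S K y * ?g y \<partial>lborel) = (\<Sum>n<K. ds_term lam a s n * (\<integral>y. ?e n y \<partial>lborel))"
      using int by simp
    then show ?thesis by (simp add: line_multiplier_def sum_distrib_left mult_ac)
  qed
  then have "(\<lambda>K. \<Sum>n<K. line_multiplier c N (lam n) * ds_term lam a s n) \<longlonglongrightarrow> ?A * (\<integral>y. ?F y * ?g y \<partial>lborel)"
    using tendsto_mult[OF tendsto_const conv, of ?A] by simp
  moreover have "norm (?A * (\<integral>y. ?F y * ?g y \<partial>lborel)) \<le> 2 * exp (- (N * c)) * norm_inf lam a"
  proof -
    have "norm (\<integral>y. (?F y * exp (of_real N * ?z y)) * line_kernel c y \<partial>lborel) \<le>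
        (norm_inf lam a * exp (N * c)) * pi / c\<^sup>2"
    proof (rule integrable_mult_line_kernel(2)[OF c])
      show "(\<lambda>y. ?F y * exp (of_real N * ?z y)) \<in> borel_measurable borel"
        by (intro borel_measurable_times measF borel_measurable_continuous_onI continuous_intros)
      show "norm (?F y * exp (of_real N * ?z y)) \<le> norm_inf lam a * exp (N * c)" for y
        using norm_ds_fun_le[OF a, of "s + ?z y"] s c by (simp add: norm_mult)
    qed
    then have bound_int: "norm (\<integral>y. ?F y * ?g y \<partial>lborel) \<le> (norm_inf lam a * exp (N * c)) * pi / c\<^sup>2"
      by (simp only: mult.assoc)
    have "norm ?A = 2 * c\<^sup>2 / pi * exp (- (2 * c * N))"
      unfolding norm_of_real by simp
    then have "norm (?A * (\<integral>y. ?F y * ?g y \<partial>lborel)) \<le>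
        2 * c\<^sup>2 / pi * exp (- (2 * c * N)) * ((norm_inf lam a * exp (N * c)) * pi / c\<^sup>2)"
      unfolding norm_mult[of ?A] using bound_int by (simp only:) (rule mult_left_mono, simp_all)
    also have "\<dots> = 2 * (exp (- (2 * c * N)) * exp (N * c)) * norm_inf lam a"
      using c by simp
    also have "exp (- (2 * c * N)) * exp (N * c) = exp (- (N * c))"
      by (simp add: exp_add[symmetric] algebra_simps)
    finally show ?thesis .
  qed
  ultimately show ?thesis by (rule that)
qed

text \<open>
  The weight \<open>b n\<close> is the difference between the factor \<open>e\<^bsup>-\<lambda>\<^sub>n\<sigma>\<^esup>\<close> of the translation and the multiplier
  with \<open>c = \<sigma>/2\<close> and \<open>N = \<lambda>\<^sub>M\<close>. It vanishes for \<open>n \<ge> M\<close>, which leaves a finite sum. The first estimate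
  serves to see that \<open>b n\<close> is nonzero for suitable \<open>\<sigma>\<close>.
\<close>
lemma translate_approx_Dirichlet_polynomial:
  assumes lam: "frequency lam" and \<sigma>: "0 < \<sigma>"
  obtains b where "\<And>n. norm (b n - exp (- (of_real (lam n) * of_real \<sigma>))) \<le>
      2 * exp (- ((lam M + lam n) * (\<sigma> / 2)))"
    and "\<And>a s. a \<in> D_inf lam \<Longrightarrow> 0 < Re s \<Longrightarrow>
      norm (ds_fun lam (ds_shift lam \<sigma> a) s - (\<Sum>n<M. b n * ds_term lam a s n)) \<le>
      2 * exp (- (lam M * (\<sigma> / 2))) * norm_inf lam a"
proof
  let ?m = "\<lambda>n. line_multiplier (\<sigma> / 2) (lam M) (lam n)"
  let ?b = "\<lambda>n. exp (- (of_real (lam n) * of_real \<sigma>)) - ?m n"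
  show "norm (?b n - exp (- (of_real (lam n) * of_real \<sigma>))) \<le> 2 * exp (- ((lam M + lam n) * (\<sigma> / 2)))" for n
    using norm_line_multiplier_le[of "\<sigma> / 2" "lam M" "lam n"] \<sigma> by simp
  fix a s assume a: "a \<in> D_inf lam" and s: "0 < Re s"
  have mono: "mono lam" "\<And>n. 0 \<le> lam n"
    using lam by (auto simp: frequency_def intro: strict_mono_mono)
  obtain L where L: "(\<lambda>K. \<Sum>n<K. ?m n * ds_term lam a s n) \<longlonglongrightarrow> L"
    "norm L \<le> 2 * exp (- (lam M * (\<sigma> / 2))) * norm_inf lam a"
    by (rule line_multiplier_series[OF mono a s, of "\<sigma> / 2" "lam M"]) (use \<sigma> in auto)
  have "summable (ds_term lam (ds_shift lam \<sigma> a) s)"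
    by (rule D_inf_summable[OF D_inf_shift[OF a] s]) (use \<sigma> in simp)
  then have shifted: "(\<lambda>K. \<Sum>n<K. ds_term lam (ds_shift lam \<sigma> a) s n) \<longlonglongrightarrow> ds_fun lam (ds_shift lam \<sigma> a) s"
    unfolding ds_fun_def by (rule summable_LIMSEQ)
  have lim: "(\<lambda>K. \<Sum>n<K. ?b n * ds_term lam a s n) \<longlonglongrightarrow> ds_fun lam (ds_shift lam \<sigma> a) s - L"
  proof -
    have "ds_term lam (ds_shift lam \<sigma> a) s n = exp (- (of_real (lam n) * of_real \<sigma>)) * ds_term lam a s n" for n
      by (simp add: ds_term_def ds_shift_def)
    then show ?thesis
      using tendsto_diff[OF shifted L(1)]
      by (simp add: sum_subtractf[symmetric] left_diff_distrib)
  qed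
  have "?b n = 0" if "M \<le> n" for n
    using line_multiplier_eq_exp[of "\<sigma> / 2" "lam M" "lam n"] monoD[OF mono(1) that] \<sigma> by simp
  then have "(\<Sum>n<K. ?b n * ds_term lam a s n) = (\<Sum>n<M. ?b n * ds_term lam a s n)" if "M \<le> K" for K
    using that by (intro sum.mono_neutral_right) auto
  then have "(\<lambda>K. \<Sum>n<K. ?b n * ds_term lam a s n) \<longlonglongrightarrow> (\<Sum>n<M. ?b n * ds_term lam a s n)"
    by (intro tendsto_eventually eventually_sequentiallyI[of M])
  then have "ds_fun lam (ds_shift lam \<sigma> a) s - L = (\<Sum>n<M. ?b n * ds_term lam a s n)"
    using lim LIMSEQ_unique by blast
  then have "ds_fun lam (ds_shift lam \<sigma> a) s - (\<Sum>n<M. ?b n * ds_term lam a s n) = L"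
    by (simp add: algebra_simps)
  then show "norm (ds_fun lam (ds_shift lam \<sigma> a) s - (\<Sum>n<M. ?b n * ds_term lam a s n)) \<le>
      2 * exp (- (lam M * (\<sigma> / 2))) * norm_inf lam a"
    using L(2) by simp
qed

section \<open>Coefficient functionals and precompactness of translations\<close>

text \<open>
  The approximating polynomial with \<open>M = n + 1\<close> ends with the \<open>n\<close>-th term, and its value at \<open>1\<close> is
  controlled by the norm. Its earlier terms are controlled by the induction hypothesis, hence so is the
  last one.
\<close>
lemma coefficient_bound:
  assumes lam: "frequency lam"
  shows "\<exists>C. \<forall>a\<in>D_inf lam. cmod (a n) \<le> C * norm_inf lam a"
proof (induction n rule: less_induct)
  case (less n)
  then obtain C where C: "\<And>k a. k < n \<Longrightarrow> a \<in> D_inf lam \<Longrightarrow> cmod (a k) \<le> C k * norm_inf lam a"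
    by metis
  define u where "u = lam (Suc n) - lam n"
  have u: "0 < u" using lam by (simp add: u_def frequency_def strict_mono_Suc_iff)
  \<comment> \<open>With this \<open>\<sigma>\<close> the multiplier at \<open>lam n\<close> is at most half the translation factor in modulus.\<close>
  define \<sigma> where "\<sigma> = 2 * ln 4 / u"
  have \<sigma>: "0 < \<sigma>" using u by (simp add: \<sigma>_def)
  obtain b where b: "\<And>k. norm (b k - exp (- (of_real (lam k) * of_real \<sigma>))) \<le>
      2 * exp (- ((lam (Suc n) + lam k) * (\<sigma> / 2)))"
    and approx: "\<And>a s. a \<in> D_inf lam \<Longrightarrow> 0 < Re s \<Longrightarrow>
      norm (ds_fun lam (ds_shift lam \<sigma> a) s - (\<Sum>k<Suc n. b k * ds_term lam a s k)) \<le>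
      2 * exp (- (lam (Suc n) * (\<sigma> / 2))) * norm_inf lam a"
    by (rule translate_approx_Dirichlet_polynomial[OF lam \<sigma>, of "Suc n"]) blast
  have "b n \<noteq> 0"
  proof
    assume "b n = 0"
    then have "exp (- (lam n * \<sigma>)) \<le> 2 * exp (- ((lam (Suc n) + lam n) * (\<sigma> / 2)))"
      using b[of n] by simp
    also have "(lam (Suc n) + lam n) * (\<sigma> / 2) = lam n * \<sigma> + ln 4"
    proof -
      have "u * (\<sigma> / 2) = ln 4" using u by (simp add: \<sigma>_def)
      moreover have "(lam (Suc n) + lam n) * (\<sigma> / 2) = lam n * \<sigma> + u * (\<sigma> / 2)"
        by (simp add: u_def field_simps)
      ultimately show ?thesis by simp
    qed
    also have "2 * exp (- (lam n * \<sigma> + ln 4)) = exp (- (lam n * \<sigma>)) / 2"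
      by (simp add: exp_diff)
    finally show False by simp
  qed
  let ?S = "\<Sum>k<n. cmod (b k) * C k"
  have main: "cmod (b n * ds_term lam a 1 n) \<le> (3 + ?S) * norm_inf lam a" if a: "a \<in> D_inf lam" for a
  proof -
    let ?f = "ds_fun lam (ds_shift lam \<sigma> a) 1"
    let ?t = "\<lambda>k. b k * ds_term lam a 1 k"
    have lam0: "0 \<le> lam k" for k using lam by (simp add: frequency_def)
    have "norm ?f \<le> norm_inf lam a"
      unfolding ds_fun_shift by (rule norm_ds_fun_le[OF a]) (use \<sigma> in simp)
    moreover have "norm (?f - (\<Sum>k<Suc n. ?t k)) \<le> 2 * norm_inf lam a"
    proof (rule order_trans[OF approx[OF a]])
      have "exp (- (lam (Suc n) * (\<sigma> / 2))) \<le> 1" using \<sigma> lam0[of "Suc n"] by simp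
      then show "2 * exp (- (lam (Suc n) * (\<sigma> / 2))) * norm_inf lam a \<le> 2 * norm_inf lam a"
        using norm_inf_nonneg[OF a] by (intro mult_right_mono) auto
    qed simp
    moreover have "norm (\<Sum>k<n. ?t k) \<le> ?S * norm_inf lam a"
    proof -
      have "norm (?t k) \<le> cmod (b k) * C k * norm_inf lam a" if "k < n" for k
      proof -
        have "norm (ds_term lam a 1 k) \<le> cmod (a k) * 1"
          unfolding ds_term_def norm_mult using lam0[of k] by (intro mult_left_mono) auto
        also have "\<dots> \<le> C k * norm_inf lam a" using C[OF that a] by simp
        finally show ?thesis by (simp add: norm_mult mult.assoc mult_left_mono)
      qed
      then show ?thesis unfolding sum_distrib_right by (intro sum_norm_le) auto
    qed
    moreover have "?t n = ?f - (?f - (\<Sum>k<Suc n. ?t k)) - (\<Sum>k<n. ?t k)" by simp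
    then have "norm (?t n) \<le> norm ?f + norm (?f - (\<Sum>k<Suc n. ?t k)) + norm (\<Sum>k<n. ?t k)"
      using norm_triangle_ineq4[of "?f - (?f - (\<Sum>k<Suc n. ?t k))" "\<Sum>k<n. ?t k"]
        norm_triangle_ineq4[of ?f "?f - (\<Sum>k<Suc n. ?t k)"] by simp
    ultimately show ?thesis by (simp add: distrib_right)
  qed
  let ?d = "cmod (b n) * exp (- lam n)"
  have "cmod (a n) \<le> (3 + ?S) / ?d * norm_inf lam a" if "a \<in> D_inf lam" for a
    using main[OF that] \<open>b n \<noteq> 0\<close> by (simp add: ds_term_def norm_mult field_simps)
  then show ?case by blast
qed

lemma norm_on_D_inf:
  assumes "frequency lam"
  shows "norm_on ds_scale (D_inf lam) (norm_inf lam)"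
  unfolding norm_on_def
proof (intro conjI ballI impI seminorm_on_norm_inf ext)
  fix a n assume a: "a \<in> D_inf lam" "norm_inf lam a = 0"
  obtain C where "\<forall>a\<in>D_inf lam. cmod (a n) \<le> C * norm_inf lam a"
    using coefficient_bound[OF assms] by blast
  then show "a n = 0 n" using a by fastforce
qed

text \<open>
  Assigning to every coordinate a ball of a finite cover sorts \<open>S\<close> into finitely many cells; one member
  of each nonempty cell gives a net that lies in \<open>S\<close> itself.
\<close>
lemma finite_net_of_bounded_coordinates:
  fixes S :: "(nat \<Rightarrow> 'a::heine_borel) set"
  assumes "\<And>n. n < M \<Longrightarrow> bounded ((\<lambda>a. a n) ` S)" "0 < \<delta>"
  shows "\<exists>K. finite K \<and> K \<subseteq> S \<and> (\<forall>a\<in>S. \<exists>b\<in>K. \<forall>n<M. dist (b n) (a n) < \<delta>)"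
proof -
  have "\<exists>T. finite T \<and> (\<lambda>a. a n) ` S \<subseteq> (\<Union>t\<in>T. ball t (\<delta> / 2))" if "n < M" for n
  proof -
    have "compact (closure ((\<lambda>a. a n) ` S))"
      using assms(1)[OF that] by (simp add: compact_closure)
    then have "\<exists>T. finite T \<and> closure ((\<lambda>a. a n) ` S) \<subseteq> (\<Union>t\<in>T. ball t (\<delta> / 2))"
      unfolding compact_eq_totally_bounded using half_gt_zero[OF assms(2)] by simp
    then show ?thesis using subset_trans[OF closure_subset] by meson
  qed
  then obtain T where T: "\<And>n. n < M \<Longrightarrow> finite (T n)"
    "\<And>n. n < M \<Longrightarrow> (\<lambda>a. a n) ` S \<subseteq> (\<Union>t\<in>T n. ball t (\<delta> / 2))" by metis
  define cell where "cell a = restrict (\<lambda>n. SOME t. t \<in> T n \<and> a n \<in> ball t (\<delta> / 2)) {..<M}" for a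
  have cell: "cell a n \<in> T n \<and> a n \<in> ball (cell a n) (\<delta> / 2)" if "a \<in> S" "n < M" for a n
  proof -
    have "\<exists>t. t \<in> T n \<and> a n \<in> ball t (\<delta> / 2)" using T(2) that by blast
    from someI_ex[OF this] show ?thesis using that by (simp add: cell_def)
  qed
  have "cell ` S \<subseteq> (\<Pi>\<^sub>E n\<in>{..<M}. T n)"
  proof (intro image_subsetI PiE_I)
    show "cell a n \<in> T n" if "a \<in> S" "n \<in> {..<M}" for a n using cell that by simp
  qed (simp add: cell_def)
  then have "finite (cell ` S)"
    using finite_subset finite_PiE[of "{..<M}" T] T(1) by auto
  then obtain K where K: "K \<subseteq> S" "finite K" "cell ` S = cell ` K"
    using finite_subset_image[of "cell ` S" cell S] by blast
  have "\<exists>b\<in>K. \<forall>n<M. dist (b n) (a n) < \<delta>" if a: "a \<in> S" for a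
  proof -
    obtain b where b: "b \<in> K" "cell b = cell a" using K(3) a by (metis imageE imageI)
    have "dist (b n) (a n) < \<delta>" if "n < M" for n
      using cell[OF a that] cell[of b n] b K(1) that dist_triangle_half_r[of "cell a n" "b n" \<delta> "a n"]
      by auto
    then show ?thesis using b(1) by blast
  qed
  then show ?thesis using K by blast
qed

lemma D_inf_diff: "a \<in> D_inf lam \<Longrightarrow> b \<in> D_inf lam \<Longrightarrow> a - b \<in> D_inf lam"
  by (rule vector_subspace_closed(3)[OF vector_subspace_D_inf])

text \<open>
  For large \<open>M\<close> the translate is within \<open>e/2\<close> of a polynomial with \<open>M\<close> terms, uniformly over differences of
  members of the unit ball. So members whose first \<open>M\<close> coefficients are close have close translates, and
  these coefficients are bounded.
\<close>
lemma precompact_translation: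
  assumes lam: "frequency lam" and \<sigma>: "0 < \<sigma>" and e: "0 < e"
    and S: "S \<subseteq> {a\<in>D_inf lam. norm_inf lam a \<le> 1}"
  shows "\<exists>K. finite K \<and> K \<subseteq> S \<and> (\<forall>a\<in>S. \<exists>b\<in>K. norm_inf lam (ds_shift lam \<sigma> (b - a)) < e)"
proof -
  have lam0: "0 \<le> lam n" for n using lam by (simp add: frequency_def)
  obtain M where M: "4 * exp (- (lam M * (\<sigma> / 2))) < e / 2"
  proof -
    obtain M where "2 / \<sigma> * ln (8 / e) < lam M"
      using lam unfolding frequency_def by (meson bdd_aboveI2 linorder_not_less)
    then have "ln (8 / e) < lam M * (\<sigma> / 2)" using \<sigma> by (simp add: field_simps)
    then have "8 / e < exp (lam M * (\<sigma> / 2))" using e exp_less_mono[of "ln (8 / e)"] by simp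
    then have "4 * exp (- (lam M * (\<sigma> / 2))) < e / 2" using e by (simp add: exp_minus field_simps)
    then show ?thesis by (rule that)
  qed
  obtain b where approx: "\<And>a s. a \<in> D_inf lam \<Longrightarrow> 0 < Re s \<Longrightarrow>
      norm (ds_fun lam (ds_shift lam \<sigma> a) s - (\<Sum>n<M. b n * ds_term lam a s n)) \<le>
      2 * exp (- (lam M * (\<sigma> / 2))) * norm_inf lam a"
    by (rule translate_approx_Dirichlet_polynomial[OF lam \<sigma>, of M]) blast
  define \<delta> where "\<delta> = e / (4 * (1 + (\<Sum>n<M. cmod (b n))))"
  have pos: "0 < 1 + (\<Sum>n<M. cmod (b n))" by (simp add: add_pos_nonneg sum_nonneg)
  then have \<delta>: "0 < \<delta>" "(\<Sum>n<M. cmod (b n)) * \<delta> < e / 4 + e / 4"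
    using e by (auto simp: \<delta>_def field_simps sum_nonneg intro!: add_pos_nonneg mult_nonneg_nonneg)
  have "bounded ((\<lambda>a. a n) ` S)" for n
  proof -
    obtain C where C: "\<forall>a\<in>D_inf lam. cmod (a n) \<le> C * norm_inf lam a"
      using coefficient_bound[OF lam] by blast
    have "cmod (a n) \<le> \<bar>C\<bar>" if "a \<in> S" for a
    proof -
      have a: "a \<in> D_inf lam" "norm_inf lam a \<le> 1" using that S by auto
      have "cmod (a n) \<le> C * norm_inf lam a" using C a by blast
      also have "\<dots> \<le> \<bar>C\<bar> * 1"
        using a norm_inf_nonneg[OF a(1)] by (intro mult_mono) auto
      finally show ?thesis by simp
    qed
    then show ?thesis unfolding bounded_iff by blast
  qed
  then have "\<exists>K. finite K \<and> K \<subseteq> S \<and> (\<forall>a\<in>S. \<exists>b\<in>K. \<forall>n<M. dist (b n) (a n) < \<delta>)"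
    by (rule finite_net_of_bounded_coordinates[OF _ \<delta>(1)])
  then obtain K where K: "finite K" "K \<subseteq> S"
    "\<forall>a\<in>S. \<exists>b\<in>K. \<forall>n<M. dist (b n) (a n) < \<delta>"
    by (elim exE conjE) (rule that)
  have "norm_inf lam (ds_shift lam \<sigma> (a' - a)) < e"
    if a: "a \<in> S" "a' \<in> S" "\<forall>n<M. dist (a' n) (a n) < \<delta>" for a a'
  proof -
    have in_D: "a \<in> D_inf lam" "a' \<in> D_inf lam" "norm_inf lam a \<le> 1" "norm_inf lam a' \<le> 1"
      using a S by auto
    let ?d = "a' - a"
    have d: "?d \<in> D_inf lam" using in_D by (intro D_inf_diff)
    have "norm_inf lam (a' + ds_scale (- 1) a) \<le> norm_inf lam a' + norm_inf lam (ds_scale (- 1) a)"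
      using in_D by (intro norm_inf_add_le D_inf_scale)
    moreover have "a' + ds_scale (- 1) a = ?d"
      by (simp add: ds_scale_def pointwise_scale_def fun_eq_iff)
    ultimately have d2: "norm_inf lam ?d \<le> 2"
      using in_D norm_inf_scale[OF in_D(1), of "- 1"] by simp
    have "norm_inf lam (ds_shift lam \<sigma> ?d) \<le>
        2 * exp (- (lam M * (\<sigma> / 2))) * 2 + (\<Sum>n<M. cmod (b n)) * \<delta>"
    proof (rule norm_inf_le)
      fix s assume s: "0 < Re s"
      have "norm (ds_fun lam (ds_shift lam \<sigma> ?d) s - (\<Sum>n<M. b n * ds_term lam ?d s n)) \<le>
          2 * exp (- (lam M * (\<sigma> / 2))) * 2"
        by (rule order_trans[OF approx[OF d s]]) (use d2 in simp)
      moreover have "norm (\<Sum>n<M. b n * ds_term lam ?d s n) \<le> (\<Sum>n<M. cmod (b n)) * \<delta>"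
        unfolding sum_distrib_right
      proof (rule sum_norm_le)
        fix n assume "n \<in> {..<M}"
        then have "norm (?d n) \<le> \<delta>" using a(3) by (auto simp: dist_norm less_imp_le)
        moreover have "norm (exp (- (of_real (lam n) * s))) \<le> 1" using lam0[of n] s by simp
        ultimately have "norm (ds_term lam ?d s n) \<le> \<delta> * 1"
          unfolding ds_term_def norm_mult using \<delta>(1) by (intro mult_mono) auto
        then show "norm (b n * ds_term lam ?d s n) \<le> cmod (b n) * \<delta>"
          by (simp add: norm_mult mult_left_mono)
      qed
      ultimately show "norm (ds_fun lam (ds_shift lam \<sigma> ?d) s) \<le>
          2 * exp (- (lam M * (\<sigma> / 2))) * 2 + (\<Sum>n<M. cmod (b n)) * \<delta>"
        using norm_triangle_sub[of "ds_fun lam (ds_shift lam \<sigma> ?d) s"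
            "\<Sum>n<M. b n * ds_term lam ?d s n"] by linarith
    qed
    then show ?thesis using M \<delta>(2) by linarith
  qed
  note close = this
  show ?thesis
  proof (intro exI[of _ K] conjI ballI K(1,2))
    fix a assume a: "a \<in> S"
    then obtain a' where "a' \<in> K" "\<forall>n<M. dist (a' n) (a n) < \<delta>" using K(3) by blast
    then show "\<exists>b\<in>K. norm_inf lam (ds_shift lam \<sigma> (b - a)) < e"
      using close[OF a, of a'] K(2) by auto
  qed
qed

section \<open>The spaces of Dirichlet series as projective limits\<close>

lemma right_half_plane_mono: "\<tau> \<le> \<sigma> \<Longrightarrow> right_half_plane \<sigma> \<subseteq> right_half_plane \<tau>"
  by (auto simp: right_half_plane_def)

lemma D_inf_plus_eq_INT: "D_inf_plus lam = (\<Inter>k. D_inf_k lam (Suc k))"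
proof (intro equalityI subsetI)
  fix a assume a: "a \<in> D_inf_plus lam"
  have "right_half_plane (1 / real (Suc k)) \<subseteq> right_half_plane 0" for k
    by (rule right_half_plane_mono) simp
  then show "a \<in> (\<Inter>k. D_inf_k lam (Suc k))"
    using a by (auto simp: D_inf_plus_def D_inf_k_def ds_shift_in_D_inf_iff ds_converges_def
        simp del: of_nat_Suc)
next
  fix a assume a: "a \<in> (\<Inter>k. D_inf_k lam (Suc k))"
  have k: "summable (ds_term lam a s)" "bounded (ds_fun lam a ` right_half_plane (1 / real (Suc k)))"
    if "s \<in> right_half_plane (1 / real (Suc k))" for s k
    using a that by (auto simp: D_inf_k_def ds_shift_in_D_inf_iff simp del: of_nat_Suc)
  have "summable (ds_term lam a s)" if s: "s \<in> right_half_plane 0" for s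
  proof -
    obtain k where "1 / real (Suc k) < Re s"
      using s nat_approx_posE[of "Re s"] by (auto simp: right_half_plane_def)
    then show ?thesis by (intro k(1)[of _ k]) (simp add: right_half_plane_def)
  qed
  moreover have "bounded (ds_fun lam a ` right_half_plane \<sigma>)" if \<sigma>: "0 < \<sigma>" for \<sigma>
  proof -
    obtain k where k': "1 / real (Suc k) < \<sigma>" by (rule nat_approx_posE[OF \<sigma>])
    have "complex_of_real \<sigma> \<in> right_half_plane (1 / real (Suc k))"
      using k' by (simp add: right_half_plane_def)
    then show ?thesis
      using k(2) right_half_plane_mono[OF less_imp_le[OF k']] by (meson bounded_subset image_mono)
  qed
  ultimately show "a \<in> D_inf_plus lam" by (simp add: D_inf_plus_def ds_converges_def)
qed

lemma seminorm_on_shift: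
  assumes V: "vector_subspace ds_scale X" and X: "\<And>a. a \<in> X \<Longrightarrow> ds_shift lam \<sigma> a \<in> D_inf lam"
  shows "seminorm_on ds_scale X (\<lambda>a. norm_inf lam (ds_shift lam \<sigma> a))"
  unfolding seminorm_on_def
  by (auto simp: V X ds_shift_linear norm_inf_nonneg norm_inf_scale norm_inf_add_le)

lemma vector_subspace_D_inf_k: "vector_subspace ds_scale (D_inf_k lam k)"
  by (rule vector_subspaceI[OF vector_space_ds_scale])
    (auto simp: D_inf_k_def ds_shift_linear D_inf_zero D_inf_add D_inf_scale)

lemma norm_on_D_inf_k:
  assumes "frequency lam"
  shows "norm_on ds_scale (D_inf_k lam k) (norm_k lam k)"
  unfolding norm_on_def
proof (intro conjI ballI impI)
  show "seminorm_on ds_scale (D_inf_k lam k) (norm_k lam k)"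
    unfolding norm_k_def [abs_def]
    by (rule seminorm_on_shift[OF vector_subspace_D_inf_k]) (simp add: D_inf_k_def)
  fix a assume "a \<in> D_inf_k lam k" "norm_k lam k a = 0"
  then have "ds_shift lam (1 / real k) a = 0"
    using norm_on_D_inf[OF assms] by (auto simp: norm_on_def D_inf_k_def norm_k_def)
  then have "ds_shift lam (- (1 / real k)) (ds_shift lam (1 / real k) a) = 0"
    by (simp add: ds_shift_linear)
  then show "a = 0" by (simp add: ds_shift_shift)
qed

lemma
  assumes a: "a \<in> D_inf_k lam (Suc l)" and kl: "k \<le> l"
  shows D_inf_k_antimono: "a \<in> D_inf_k lam (Suc k)"
    and norm_k_mono: "norm_k lam (Suc k) a \<le> norm_k lam (Suc l) a"
proof -
  let ?d = "1 / real (Suc k) - 1 / real (Suc l)"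
  have d: "0 \<le> ?d" using kl by (simp add: frac_le)
  have "ds_shift lam (1 / real (Suc k)) a = ds_shift lam ?d (ds_shift lam (1 / real (Suc l)) a)"
    by (simp add: ds_shift_shift)
  then show "a \<in> D_inf_k lam (Suc k)" "norm_k lam (Suc k) a \<le> norm_k lam (Suc l) a"
    using a D_inf_shift[OF _ d] norm_inf_shift_le[OF _ d]
    by (simp_all add: D_inf_k_def norm_k_def del: of_nat_Suc)
qed

lemma D_inf_plus_norms_eq: "D_inf_plus_norms lam = range (norms1 lam)"
proof -
  have "{1..} = range Suc" by (auto simp: image_iff) (metis Suc_le_D)
  then show ?thesis by (simp add: D_inf_plus_norms_def image_image)
qed

lemma vector_subspace_D_inf_plus: "vector_subspace ds_scale (D_inf_plus lam)"
  by (rule vector_subspaceI[OF vector_space_ds_scale])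
    (auto simp: D_inf_plus_eq_INT intro: vector_subspace_closed[OF vector_subspace_D_inf_k]
      vector_subspace_scale[OF vector_subspace_D_inf_k])

lemma seminorm_on_D_inf_plus: "seminorm_on ds_scale (D_inf_plus lam) (norm_k lam (Suc k))"
  unfolding norm_k_def [abs_def]
  by (rule seminorm_on_shift[OF vector_subspace_D_inf_plus]) (auto simp: D_inf_plus_eq_INT D_inf_k_def)

lemma pre_Frechet_D_inf_plus:
  assumes "frequency lam"
  shows "pre_Frechet ds_scale (D_inf_plus lam) (seminorm_topology (D_inf_plus lam) (range (norms1 lam)))"
proof (rule pre_Frechet_seminorm_topology[OF vector_subspace_D_inf_plus seminorm_on_D_inf_plus])
  fix a assume "a \<in> D_inf_plus lam" "a \<noteq> 0"
  then show "\<exists>k. norm_k lam (Suc k) a \<noteq> 0"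
    using norm_on_D_inf_k[OF assms, of "Suc 0"] by (auto simp: D_inf_plus_eq_INT norm_on_def)
qed

text \<open>
  The unit ball of the \<open>(k+2)\<close>-nd norm corresponds, under translation by \<open>1/(k+2)\<close>, to a subset of the unit
  ball of \<open>\<D>\<^sub>\<infinity>(\<lambda>)\<close>, and the remaining translation by \<open>1/(k+1) - 1/(k+2) > 0\<close> is precompact.
\<close>
lemma canonical_map_precompact_D_inf_plus:
  assumes "frequency lam"
  shows "canonical_map_precompact (D_inf_plus lam) (norm_k lam (Suc (Suc k))) (norm_k lam (Suc k))"
proof (rule canonical_map_precompactI[OF seminorm_on_D_inf_plus seminorm_on_D_inf_plus, where c = 1])
  show "norm_k lam (Suc k) a \<le> 1 * norm_k lam (Suc (Suc k)) a" if "a \<in> D_inf_plus lam" for a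
    using that norm_k_mono[of a lam "Suc k" k] by (auto simp: D_inf_plus_eq_INT)
  fix e :: real assume e: "0 < e"
  let ?t = "1 / real (Suc (Suc k))" and ?\<sigma> = "1 / real (Suc k) - 1 / real (Suc (Suc k))"
  let ?B = "{a \<in> D_inf_plus lam. norm_k lam (Suc (Suc k)) a \<le> 1}"
  have \<sigma>: "0 < ?\<sigma>" by (simp add: frac_less2)
  have "ds_shift lam ?t ` ?B \<subseteq> {a\<in>D_inf lam. norm_inf lam a \<le> 1}"
    by (auto simp: D_inf_plus_eq_INT D_inf_k_def norm_k_def simp del: of_nat_Suc)
  from precompact_translation[OF assms \<sigma> e this]
  obtain K' where K': "finite K'" "K' \<subseteq> ds_shift lam ?t ` ?B"
    "\<And>a. a \<in> ?B \<Longrightarrow> \<exists>b\<in>K'. norm_inf lam (ds_shift lam ?\<sigma> (b - ds_shift lam ?t a)) < e"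
    by blast
  then obtain K where K: "K \<subseteq> ?B" "finite K" "K' = ds_shift lam ?t ` K"
    by (meson finite_subset_image)
  have "\<exists>b\<in>K. norm_k lam (Suc k) (b - a) < e" if a: "a \<in> ?B" for a
  proof -
    obtain b where b: "b \<in> K" "norm_inf lam (ds_shift lam ?\<sigma> (ds_shift lam ?t b - ds_shift lam ?t a)) < e"
      using K'(3)[OF a] K(3) by blast
    have "ds_shift lam ?\<sigma> (ds_shift lam ?t b - ds_shift lam ?t a) = ds_shift lam (1 / real (Suc k)) (b - a)"
      by (simp add: ds_shift_linear(2)[symmetric] ds_shift_shift)
    then show ?thesis using b by (auto simp: norm_k_def)
  qed
  then show "\<exists>K. finite K \<and> K \<subseteq> ?B \<and>
      (\<forall>a\<in>D_inf_plus lam. norm_k lam (Suc (Suc k)) a \<le> 1 \<longrightarrow> (\<exists>b\<in>K. norm_k lam (Suc k) (b - a) < e))"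
    using K by blast
qed

lemma Schwartz_system_D_inf_plus:
  assumes "frequency lam"
  shows "Schwartz_system ds_scale (D_inf_plus lam) (D_inf_plus_norms lam)"
proof -
  have mono: "norm_k lam (Suc k) a \<le> norm_k lam (Suc l) a" if "k \<le> l" "a \<in> D_inf_plus lam" for k l a
    using that norm_k_mono by (auto simp: D_inf_plus_eq_INT)
  show ?thesis
    unfolding Schwartz_system_def D_inf_plus_norms_eq
  proof (intro conjI ballI)
    fix p q assume "p \<in> range (norms1 lam)" "q \<in> range (norms1 lam)"
    then obtain k l where kl: "p = norms1 lam k" "q = norms1 lam l" by blast
    then show "\<exists>r\<in>range (norms1 lam). \<forall>a\<in>D_inf_plus lam. p a \<le> r a \<and> q a \<le> r a"
      by (intro bexI[of _ "norms1 lam (max k l)"]) (auto intro!: mono)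
  next
    fix q assume "q \<in> range (norms1 lam)"
    then obtain k where k: "q = norms1 lam k" by blast
    show "\<exists>p\<in>range (norms1 lam). \<exists>c>0. (\<forall>a\<in>D_inf_plus lam. q a \<le> c * p a) \<and>
        canonical_map_precompact (D_inf_plus lam) p q"
    proof (intro bexI[of _ "norms1 lam (Suc k)"] exI[of _ "1::real"] conjI ballI)
      show "canonical_map_precompact (D_inf_plus lam) (norms1 lam (Suc k)) q"
        unfolding k by (rule canonical_map_precompact_D_inf_plus[OF assms])
    qed (use mono k in auto)
  qed (auto intro: seminorm_on_D_inf_plus)
qed

lemma projective_spectrum_D_inf_k:
  assumes "frequency lam"
  shows "projective_spectrum ds_scale (spaces1 lam) (norms1 lam) maps1"
  unfolding projective_spectrum_def bounded_operator_def
proof (intro allI conjI norm_on_D_inf_k[OF assms])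
  fix k
  show "linear_on ds_scale (D_inf_k lam (Suc (Suc k))) ds_scale (D_inf_k lam (Suc k)) (inj_map (Suc k))"
    using D_inf_k_antimono[of _ lam "Suc k" k] vector_subspace_D_inf_k
    by (auto simp: linear_on_def inj_map_def)
  show "\<exists>C. \<forall>a\<in>D_inf_k lam (Suc (Suc k)). norm_k lam (Suc k) (inj_map (Suc k) a) \<le> C * norm_k lam (Suc (Suc k)) a"
    using norm_k_mono[of _ lam "Suc k" k] by (intro exI[of _ 1]) (auto simp: inj_map_def)
qed

lemma projective_spectrum_tau:
  assumes "frequency lam"
  shows "projective_spectrum ds_scale (spaces2 lam) (norms2 lam) (maps2 lam)"
  unfolding projective_spectrum_def bounded_operator_def
proof (intro allI conjI norm_on_D_inf[OF assms])
  fix k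
  have d: "0 \<le> 1 / real (Suc k) - 1 / real (Suc (Suc k))" by (simp add: frac_le)
  show "linear_on ds_scale (D_inf lam) ds_scale (D_inf lam) (tau_map lam (Suc k))"
    using D_inf_shift[OF _ d] vector_subspace_D_inf
    by (auto simp: linear_on_def tau_map_def ds_shift_linear)
  show "\<exists>C. \<forall>a\<in>D_inf lam. norm_inf lam (tau_map lam (Suc k) a) \<le> C * norm_inf lam a"
    using norm_inf_shift_le[OF _ d] by (intro exI[of _ 1]) (auto simp: tau_map_def)
qed

lemma pre_Frechet_iso_inclusion:
  assumes "frequency lam"
  shows "pre_Frechet_iso ds_scale (D_inf_plus lam) (D_inf_plus_topology lam)
    (pointwise_scale ds_scale) (proj_space (spaces1 lam) maps1)
    (proj_topology (spaces1 lam) (norms1 lam) maps1) (\<lambda>D k. D)"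
  unfolding D_inf_plus_topology_def D_inf_plus_norms_eq
proof (rule pre_Frechet_iso_proj)
  note spec = projective_spectrum_D_inf_k[OF assms]
  show "projective_spectrum ds_scale (spaces1 lam) (norms1 lam) maps1" by (rule spec)
  have img: "(\<lambda>D k. D) ` D_inf_plus lam = proj_space (spaces1 lam) maps1"
  proof (intro equalityI subsetI)
    fix x assume x: "x \<in> proj_space (spaces1 lam) maps1"
    have "x k = x 0" for k
      using x by (induction k) (auto simp: proj_space_def inj_map_def)
    then have "x = (\<lambda>k. x 0)" "x 0 \<in> D_inf_plus lam"
      using x by (auto simp: proj_space_def D_inf_plus_eq_INT) metis
    then show "x \<in> (\<lambda>D k. D) ` D_inf_plus lam" by blast
  qed (auto simp: proj_space_def D_inf_plus_eq_INT inj_map_def)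
  then show "bij_betw (\<lambda>D k. D) (D_inf_plus lam) (proj_space (spaces1 lam) maps1)"
    by (auto simp: bij_betw_def inj_on_def fun_eq_iff)
  show "linear_on ds_scale (D_inf_plus lam) (pointwise_scale ds_scale) (proj_space (spaces1 lam) maps1) (\<lambda>D k. D)"
    using img vector_subspace_D_inf_plus vector_subspace_proj_space[OF spec]
    by (auto simp: linear_on_def pointwise_scale_def fun_eq_iff)
qed (use pre_Frechet_D_inf_plus[OF assms] in auto)

text \<open>
  The inverse recovers \<open>D\<close> from the first coordinate \<open>D\<^sub>1\<close> by translating back. The compatibility of
  a point of the projective limit with the maps \<open>\<tau>\<^sub>k\<close> says that its other coordinates are translates of
  this same \<open>D\<close>.
\<close>
lemma pre_Frechet_iso_translates:
  assumes "frequency lam"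
  shows "pre_Frechet_iso ds_scale (D_inf_plus lam) (D_inf_plus_topology lam)
    (pointwise_scale ds_scale) (proj_space (spaces2 lam) (maps2 lam))
    (proj_topology (spaces2 lam) (norms2 lam) (maps2 lam))
    (\<lambda>D k. ds_shift lam (1 / real (Suc k)) D)"
  unfolding D_inf_plus_topology_def D_inf_plus_norms_eq
proof (rule pre_Frechet_iso_proj)
  note spec = projective_spectrum_tau[OF assms]
  let ?f = "\<lambda>D k. ds_shift lam (1 / real (Suc k)) D"
  let ?Y = "proj_space (spaces2 lam) (maps2 lam)"
  show "projective_spectrum ds_scale (spaces2 lam) (norms2 lam) (maps2 lam)" by (rule spec)
  have img: "?f ` D_inf_plus lam = ?Y"
  proof (intro equalityI subsetI)
    fix x assume x: "x \<in> ?Y"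
    define D where "D = ds_shift lam (- 1) (x 0)"
    have D: "ds_shift lam (1 / real (Suc k)) D = x k" for k
    proof (induction k)
      case 0
      show ?case by (simp add: D_def ds_shift_shift)
    next
      case (Suc k)
      let ?d = "1 / real (Suc k) - 1 / real (Suc (Suc k))"
      have "ds_shift lam ?d (x (Suc k)) = x k"
        using x by (auto simp: proj_space_def tau_map_def)
      then have "x (Suc k) = ds_shift lam (- ?d) (x k)"
        by (metis ds_shift_shift ds_shift_0 add.left_inverse)
      also have "\<dots> = ds_shift lam (- ?d) (ds_shift lam (1 / real (Suc k)) D)"
        by (simp only: Suc.IH)
      also have "\<dots> = ds_shift lam (1 / real (Suc (Suc k))) D"
        by (simp add: ds_shift_shift)
      finally show ?case ..
    qed
    then have "?f D = x" by (simp add: fun_eq_iff[of "?f D"])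
    moreover have "D \<in> D_inf_plus lam"
      using x D by (auto simp: D_inf_plus_eq_INT D_inf_k_def proj_space_def simp del: of_nat_Suc)
    ultimately show "x \<in> ?f ` D_inf_plus lam" by blast
  qed (auto simp: proj_space_def D_inf_plus_eq_INT D_inf_k_def tau_map_def ds_shift_shift simp del: of_nat_Suc)
  have "D = D'" if "?f D = ?f D'" for D D'
  proof -
    have "ds_shift lam 1 D = ds_shift lam 1 D'" using fun_cong[OF that, of 0] by simp
    then have "ds_shift lam (- 1) (ds_shift lam 1 D) = ds_shift lam (- 1) (ds_shift lam 1 D')" by simp
    then show ?thesis by (simp add: ds_shift_shift)
  qed
  then show "bij_betw ?f (D_inf_plus lam) ?Y"
    using img unfolding bij_betw_def inj_on_def by blast
  show "linear_on ds_scale (D_inf_plus lam) (pointwise_scale ds_scale) ?Y ?f"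
    using img vector_subspace_D_inf_plus vector_subspace_proj_space[OF spec]
    by (auto simp: linear_on_def pointwise_scale_def fun_eq_iff ds_shift_linear)
qed (use pre_Frechet_D_inf_plus[OF assms] in \<open>auto simp: norm_k_def\<close>)

theorem proposition5p1:
  fixes lam :: "nat \<Rightarrow> real"
  assumes "frequency lam"
  shows "pre_Frechet ds_scale (D_inf_plus lam) (D_inf_plus_topology lam)
    \<and> Schwartz_system ds_scale (D_inf_plus lam) (D_inf_plus_norms lam)
    \<and> projective_spectrum ds_scale (spaces1 lam) (norms1 lam) maps1
    \<and> pre_Frechet_iso
        ds_scale (D_inf_plus lam) (D_inf_plus_topology lam)
        (pointwise_scale ds_scale) (proj_space (spaces1 lam) maps1)
        (proj_topology (spaces1 lam) (norms1 lam) maps1)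
        (\<lambda>D k. D)
    \<and> projective_spectrum ds_scale (spaces2 lam) (norms2 lam) (maps2 lam)
    \<and> pre_Frechet_iso
        ds_scale (D_inf_plus lam) (D_inf_plus_topology lam)
        (pointwise_scale ds_scale) (proj_space (spaces2 lam) (maps2 lam))
        (proj_topology (spaces2 lam) (norms2 lam) (maps2 lam))
        (\<lambda>D k. ds_shift lam (1 / real (Suc k)) D)"
  using pre_Frechet_iso_inclusion[OF assms] pre_Frechet_iso_translates[OF assms]
    Schwartz_system_D_inf_plus[OF assms]
    projective_spectrum_D_inf_k[OF assms] projective_spectrum_tau[OF assms]
  unfolding pre_Frechet_iso_def by blast

end
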